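(* Let $k\ge 0$ be an integer, let $G$ be a connected split graph, regarded as a graph of goods, and let $N=[n]$ be a set of $n\ge1$ agents with nonnegative additive utility functions $u_1,\dots,u_n$ on $V(G)$ such that the agents are of at most $2^k$ types. Then there exists a $\frac{3}{7\cdot 2^k-3}$-mms-allocation, i.e., a $(G,n)$-partition $(A_1,\dots,A_n)$ of $V(G)$ into bundles such that $u_i(A_i)\ge \frac{3}{7\cdot 2^k-3}\,\mathsf{mms}^{(n)}(G,u_i)$ for every $i\in[n]$.
   Context: A split graph is a graph whose vertex set can be partitioned into a set $K$ inducing a complete graph and an independent set $I$. Goods are the vertices of $G$. Each agent $i$ has a utility function $u_i$ assigning a nonnegative real to each vertex, extended additively to sets: $u_i(X)=\sum_{v\in X}u_i(v)$, $u_i(\emptyset)=0$. Agents are of the same type if they have the same utility function; "at most $t$ types" means the set $\{u_1,\dots,u_n\}$ has at most $t$ distinct functions. A bundle is a set $X\subseteq V(G)$ inducing a connected subgraph of $G$ (the empty set is a bundle). A $(G,n)$-partition is a tuple $(P_1,\dots,P_n)$ of pairwise disjoint bundles with $\bigcup_j P_j=V(G)$; as an allocation, $P_i$ is given to agent $i$. The maximin share is $\mathsf{mms}^{(n)}(G,u)=\max_{(P_1,\dots,P_n)}\min_{j\in[n]}u(P_j)$, the maximum over all $(G,n)$-partitions. *)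

theory Defs
  imports Complex_Main "HOL-Library.FuncSet" "HOL-Library.Disjoint_Sets"
    "Graph_Theory.Graph_Theory"
begin

text \<open>
  A finite simple undirected graph is an instance of the locale \<^locale>\<open>graph\<close>: a finite,
  loop-free digraph without parallel arcs in which every arc has a reverse arc.
\<close>

definition independent_set :: "('a,'b) pre_digraph \<Rightarrow> 'a set \<Rightarrow> bool" where
  "independent_set G S \<longleftrightarrow> S \<subseteq> verts G \<and> (\<forall>x\<in>S. \<forall>y\<in>S. \<not> x \<rightarrow>\<^bsub>G\<^esub> y)"

definition split_graph :: "('a,'b) pre_digraph \<Rightarrow> bool" where
  "split_graph G \<longleftrightarrow> graph G \<and>
     (\<exists>K I. K \<union> I = verts G \<and> K \<inter> I = {} \<and>
        complete_digraph (card K) (G \<restriction> K) \<and> independent_set G I)"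

text \<open>
  The library predicate \<^const>\<open>connected\<close> is false for the graph without vertices, whereas
  the empty set counts as a bundle.
\<close>

definition is_bundle :: "('a,'b) pre_digraph \<Rightarrow> 'a set \<Rightarrow> bool" where
  "is_bundle G X \<longleftrightarrow> X \<subseteq> verts G \<and> (X = {} \<or> connected (G \<restriction> X))"

text \<open>
  Tuples indexed by \<open>1, \<dots>, n\<close> are functions on \<^typ>\<open>nat\<close> whose values
  outside \<open>{1..n}\<close> are irrelevant.
\<close>

definition graph_partition :: "('a,'b) pre_digraph \<Rightarrow> nat \<Rightarrow> (nat \<Rightarrow> 'a set) \<Rightarrow> bool" where
  "graph_partition G n P \<longleftrightarrow>
     (\<forall>j\<in>{1..n}. is_bundle G (P j)) \<and>
     disjoint_family_on P {1..n} \<and>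
     (\<Union>j\<in>{1..n}. P j) = verts G"

definition utility :: "('a \<Rightarrow> real) \<Rightarrow> 'a set \<Rightarrow> real" where
  "utility u X = (\<Sum>v\<in>X. u v)"

definition mms :: "nat \<Rightarrow> ('a,'b) pre_digraph \<Rightarrow> ('a \<Rightarrow> real) \<Rightarrow> real" where
  "mms n G u = Max {Min ((\<lambda>j. utility u (P j)) ` {1..n}) | P. graph_partition G n P}"

text \<open>
  Utility functions have domain \<^term>\<open>verts G\<close>, so two agents have the same type iff their
  utilities agree there; \<^const>\<open>restrict\<close> discards the values outside.
\<close>

definition agent_types :: "('a,'b) pre_digraph \<Rightarrow> nat \<Rightarrow> (nat \<Rightarrow> 'a \<Rightarrow> real) \<Rightarrow> ('a \<Rightarrow> real) set" where
  "agent_types G n u = (\<lambda>i. restrict (u i) (verts G)) ` {1..n}"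

definition mms_allocation ::
  "real \<Rightarrow> ('a,'b) pre_digraph \<Rightarrow> nat \<Rightarrow> (nat \<Rightarrow> 'a \<Rightarrow> real) \<Rightarrow> (nat \<Rightarrow> 'a set) \<Rightarrow> bool" where
  "mms_allocation \<alpha> G n u A \<longleftrightarrow>
     graph_partition G n A \<and> (\<forall>i\<in>{1..n}. utility (u i) (A i) \<ge> \<alpha> * mms n G (u i))"

text \<open>The \<^const>\<open>Max\<close> in \<^const>\<open>mms\<close> is taken over a finite nonempty set.\<close>

lemma finite_mms_values:
  assumes "finite (verts G)" "n \<ge> 1"
  shows "finite {Min ((\<lambda>j. utility u (P j)) ` {1..n}) | P. graph_partition G n P}"
proof (rule finite_subset)
  show "{Min ((\<lambda>j. utility u (P j)) ` {1..n}) | P. graph_partition G n P}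
          \<subseteq> utility u ` Pow (verts G)"
  proof clarify
    fix P assume P: "graph_partition G n P"
    have "Min ((\<lambda>j. utility u (P j)) ` {1..n}) \<in> (\<lambda>j. utility u (P j)) ` {1..n}"
      using assms(2) by (intro Min_in) auto
    then obtain j where "j \<in> {1..n}" "Min ((\<lambda>j. utility u (P j)) ` {1..n}) = utility u (P j)"
      by blast
    moreover from this P have "P j \<subseteq> verts G"
      by (auto simp: graph_partition_def is_bundle_def)
    ultimately show "Min ((\<lambda>j. utility u (P j)) ` {1..n}) \<in> utility u ` Pow (verts G)"
      by blast
  qed
  show "finite (utility u ` Pow (verts G))" using assms(1) by simp
qed

lemma mms_values_nonempty:
  assumes "graph G" "connected G" "n \<ge> 1"
  shows "{Min ((\<lambda>j. utility u (P j)) ` {1..n}) | P. graph_partition G n P} \<noteq> {}"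
proof -
  interpret graph G by (rule assms(1))
  have "G \<restriction> verts G = G"
    by (intro pre_digraph.equality) (auto simp: induce_subgraph_def intro: wellformed)
  then have "graph_partition G n (\<lambda>j. if j = 1 then verts G else {})"
    using assms(2,3)
    by (auto simp: graph_partition_def is_bundle_def disjoint_family_on_def split: if_splits)
  then show ?thesis by blast
qed

end

theory Submission
  imports Defs "HOL-Library.Infinite_Set"
begin

text \<open>
  Put \<open>t = 2^k\<close> and \<open>a = 3 / (7t - 3)\<close>, and scale all maximin shares to 1. An agent who values
  some vertex at \<open>a\<close> or more can be given that vertex and dropped, since the removal destroys only one
  bundle of every other agent's maximin partition; so all vertices may be assumed to be worth less
  than \<open>a\<close>. For every type, the vertices of the independent set in each of its bundles are cut, in
  descending order of value, into blocks of \<open>t\<close>. By Hall's theorem the types can choose disjoint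
  transversals of their blocks, and a type keeps at least \<open>(1 - (t-1)a) / t = 4a/3\<close> of every bundle.
  Attaching the chosen vertices to clique vertices of the same bundle yields one clustering that
  suits all types, in which any union of clusters is connected. What remains is fair division
  without connectivity constraints, where a 3/4 fraction of the maximin share is always attainable:
  this is proved by reduction rules and bag filling, following Garg and Taki. Finally,
  the unused vertices are added to the bundles using connectivity of \<open>G\<close>.
\<close>

section \<open>Ordered instances and reductions\<close>

text \<open>A vertex of the independent set is usable only beside one of its neighbours, and the
  maximin partitions of different types place it beside different ones. A clustering common to all
  types must settle on one neighbour, so each such vertex can be reserved for one type only.
  Reserving is possible because a vertex lies in at most one block of each of the at most
  \<open>t\<close> types, while a block has \<open>t\<close> elements: this is Hall's condition. It
  is cheap because the chosen element of a block is worth at least every element of the next block: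
  \<open>t\<close> times the transversal pays for all but \<open>t - 1\<close> independent vertices
  of a bundle, and those cost at most \<open>a\<close> each, which is why vertices worth
  \<open>a\<close> or more are removed beforehand. Clique vertices are cluster centres and are never
  lost. The constant solves \<open>(1 - (t - 1) * a) / t = 4 * a / 3\<close>, where 4/3 compensates
  for the factor 3/4 of the last stage.\<close>

definition has_packing :: "('a \<Rightarrow> real) \<Rightarrow> nat \<Rightarrow> 'a set \<Rightarrow> bool" where
  "has_packing f n X \<longleftrightarrow> (\<exists>(P :: nat \<Rightarrow> 'a set) J. finite J \<and> card J = n \<and> disjoint_family_on P J \<and>
     (\<forall>j\<in>J. finite (P j) \<and> P j \<subseteq> X \<and> 1 \<le> sum f (P j)))"

lemma has_packingI:
  fixes P :: "nat \<Rightarrow> 'a set"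
  assumes "finite J" "card J = n" "disjoint_family_on P J"
    "\<And>j. j \<in> J \<Longrightarrow> finite (P j) \<and> P j \<subseteq> X \<and> 1 \<le> sum f (P j)"
  shows "has_packing f n X"
  using assms unfolding has_packing_def by blast

lemma has_packingE:
  assumes "has_packing f n X"
  obtains P :: "nat \<Rightarrow> 'a set" and J where "finite J" "card J = n" "disjoint_family_on P J"
    "\<And>j. j \<in> J \<Longrightarrow> finite (P j)" "\<And>j. j \<in> J \<Longrightarrow> P j \<subseteq> X" "\<And>j. j \<in> J \<Longrightarrow> 1 \<le> sum f (P j)"
  using assms unfolding has_packing_def by blast

lemma disjoint_family_on_eq_index:
  "disjoint_family_on P J \<Longrightarrow> i \<in> J \<Longrightarrow> j \<in> J \<Longrightarrow> x \<in> P i \<Longrightarrow> x \<in> P j \<Longrightarrow> i = j"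
  unfolding disjoint_family_on_def by blast

section \<open>Exchange arguments and reductions\<close>

text \<open>The bundle \<open>P0\<close> is sacrificed to free the goods of \<open>S\<close>: a
  bundle that loses \<open>s\<close> receives \<open>h s\<close> from \<open>P0\<close>, worth at
  least as much since \<open>h s \<le> s\<close> and \<open>w\<close> is descending.\<close>

lemma exchange_out:
  fixes w :: "nat \<Rightarrow> real" and Q :: "'i \<Rightarrow> nat set"
  assumes "finite S" "antimono w" "inj_on h S" "h ` S \<subseteq> P0" "\<And>s. s \<in> S \<Longrightarrow> h s \<le> s"
    "disjoint_family_on Q J" "\<And>j. j \<in> J \<Longrightarrow> Q j \<inter> P0 = {}" "\<And>j. j \<in> J \<Longrightarrow> finite (Q j)"
  shows "\<exists>Q'. disjoint_family_on Q' J \<and>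
    (\<forall>j\<in>J. finite (Q' j) \<and> Q' j \<inter> S = {} \<and> Q' j \<subseteq> \<Union>(Q ` J) \<union> P0 \<and> sum w (Q j) \<le> sum w (Q' j))"
  using assms
proof (induction S arbitrary: h P0 Q rule: finite_induct)
  case empty
  then show ?case by (intro exI[of _ Q]) auto
next
  case (insert s S)
  show ?case
  proof (cases "s \<in> P0")
    case True
    \<comment> \<open>Here \<open>s\<close> lies in the sacrificed bundle, so no other bundle has to
      give it up. If \<open>s\<close> was itself the replacement for some \<open>x\<close>, the free
      good \<open>h s\<close> takes over, and \<open>h s \<le> s \<le> x\<close>.\<close>
    define h' where "h' = (\<lambda>x. if h x = s then h s else h x)"
    have hs: "h x \<noteq> h s" if "x \<in> S" for x
      using insert.prems(2) insert.hyps(2) that by (auto simp: inj_on_def)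
    have "\<exists>Q'. disjoint_family_on Q' J \<and>
      (\<forall>j\<in>J. finite (Q' j) \<and> Q' j \<inter> S = {} \<and> Q' j \<subseteq> \<Union>(Q ` J) \<union> (P0 - {s}) \<and> sum w (Q j) \<le> sum w (Q' j))"
    proof (rule insert.IH[of h'])
      show "inj_on h' S"
        using insert.prems(2) hs unfolding h'_def inj_on_def by (metis insertI2)
      show "h' ` S \<subseteq> P0 - {s}"
        using insert.prems(3) hs unfolding h'_def by (auto, metis)
      show "h' x \<le> x" if "x \<in> S" for x
        using insert.prems(4)[of x] insert.prems(4)[of s] that unfolding h'_def by auto
    qed (use insert.prems in auto)
    then obtain Q' where "disjoint_family_on Q' J" and
      Q': "\<And>j. j \<in> J \<Longrightarrow> finite (Q' j) \<and> Q' j \<inter> S = {} \<and> Q' j \<subseteq> \<Union>(Q ` J) \<union> (P0 - {s}) \<and> sum w (Q j) \<le> sum w (Q' j)"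
      by blast
    moreover have "s \<notin> \<Union>(Q ` J)" using insert.prems(6) True by auto
    ultimately show ?thesis
      by (intro exI[of _ Q'] conjI ballI) (use Q' in blast)+
  next
    case False
    define R where "R = (\<lambda>j. if s \<in> Q j then insert (h s) (Q j - {s}) else Q j)"
    have hsP: "h s \<in> P0" using insert.prems(3) by auto
    then have hsQ: "h s \<notin> Q j" if "j \<in> J" for j using insert.prems(6)[OF that] by auto
    have disR: "disjoint_family_on R J"
      unfolding disjoint_family_on_def
    proof (intro ballI impI)
      fix i j assume ij: "i \<in> J" "j \<in> J" "i \<noteq> j"
      then have "Q i \<inter> Q j = {}" using insert.prems(5) unfolding disjoint_family_on_def by blast
      then show "R i \<inter> R j = {}" using hsQ ij unfolding R_def by auto
    qed
    have sumR: "sum w (Q j) \<le> sum w (R j)" if "j \<in> J" for j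
    proof (cases "s \<in> Q j")
      case True
      have "sum w (Q j) = w s + sum w (Q j - {s})"
        using True insert.prems(7)[OF that] by (simp add: sum.remove)
      also have "\<dots> \<le> w (h s) + sum w (Q j - {s})"
        using insert.prems(4)[of s] antimonoD[OF insert.prems(1)] by simp
      also have "\<dots> = sum w (R j)"
        using True hsQ[OF that] insert.prems(7)[OF that] by (simp add: R_def)
      finally show ?thesis .
    qed (simp add: R_def)
    have "\<exists>Q'. disjoint_family_on Q' J \<and>
      (\<forall>j\<in>J. finite (Q' j) \<and> Q' j \<inter> S = {} \<and> Q' j \<subseteq> \<Union>(R ` J) \<union> (P0 - {h s}) \<and> sum w (R j) \<le> sum w (Q' j))"
    proof (rule insert.IH[of h])
      show "inj_on h S" using insert.prems(2) by auto
      show "h ` S \<subseteq> P0 - {h s}"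
        using insert.prems(2,3) insert.hyps(2) by (auto simp: inj_on_def)
      show "R j \<inter> (P0 - {h s}) = {}" if "j \<in> J" for j
        using insert.prems(6)[OF that] by (auto simp: R_def)
      show "finite (R j)" if "j \<in> J" for j
        using insert.prems(7)[OF that] by (auto simp: R_def)
    qed (use insert.prems disR in auto)
    then obtain Q' where disQ': "disjoint_family_on Q' J" and
      Q': "\<And>j. j \<in> J \<Longrightarrow> finite (Q' j) \<and> Q' j \<inter> S = {} \<and> Q' j \<subseteq> \<Union>(R ` J) \<union> (P0 - {h s}) \<and> sum w (R j) \<le> sum w (Q' j)"
      by blast
    have RJ: "\<Union>(R ` J) \<subseteq> \<Union>(Q ` J) \<union> P0" using hsP by (auto simp: R_def split: if_splits)
    have "s \<notin> R j" if "j \<in> J" for j using False hsP by (auto simp: R_def)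
    then have "s \<notin> \<Union>(R ` J)" by blast
    then have "Q' j \<inter> insert s S = {}" if "j \<in> J" for j using Q'[OF that] False by auto
    moreover have "Q' j \<subseteq> \<Union>(Q ` J) \<union> P0" if "j \<in> J" for j using Q'[OF that] RJ by blast
    moreover have "sum w (Q j) \<le> sum w (Q' j)" if "j \<in> J" for j
      using Q'[OF that] sumR[OF that] by auto
    ultimately show ?thesis using disQ' Q' by blast
  qed
qed

text \<open>Send \<open>N - 1\<close> to the largest element of \<open>X\<close>,
  \<open>N - 2\<close> to the second largest, and so on: the elements of \<open>X\<close> descend
  from below \<open>N\<close> in steps of at least 1.\<close>

lemma dominating_injection:
  fixes X :: "nat set"
  assumes "X \<subseteq> {..<N}" "r \<le> card X"
  shows "\<exists>h. inj_on h {N-r..<N} \<and> h ` {N-r..<N} \<subseteq> X \<and> (\<forall>s\<in>{N-r..<N}. h s \<le> s)"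
  using assms
proof (induction r arbitrary: X N)
  case 0
  then show ?case by auto
next
  case (Suc r)
  have fin: "finite X" using Suc.prems(1) finite_subset by blast
  have ne: "X \<noteq> {}" using Suc.prems(2) by auto
  define M where "M = Max X"
  have M: "M \<in> X" "\<And>x. x \<in> X \<Longrightarrow> x \<le> M" using fin ne by (auto simp: M_def)
  have "M < N" using M Suc.prems(1) by auto
  have "X - {M} \<subseteq> {..<N-1}" using M Suc.prems(1) by force
  moreover have "r \<le> card (X - {M})" using Suc.prems(2) M(1) fin by simp
  ultimately obtain h where h: "inj_on h {N-1-r..<N-1}" "h ` {N-1-r..<N-1} \<subseteq> X - {M}"
    "\<forall>s\<in>{N-1-r..<N-1}. h s \<le> s" using Suc.IH by blast
  have eq: "{N-Suc r..<N} = insert (N-1) {N-1-r..<N-1}" using \<open>M < N\<close> by auto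
  have "inj_on (h(N-1 := M)) (insert (N-1) {N-1-r..<N-1})"
    using h by (auto simp: inj_on_def)
  moreover have "(h(N-1 := M)) ` (insert (N-1) {N-1-r..<N-1}) \<subseteq> X" using h M by auto
  moreover have "\<forall>s\<in>insert (N-1) {N-1-r..<N-1}. (h(N-1 := M)) s \<le> s" using h \<open>M < N\<close> by auto
  ultimately show ?case unfolding eq by blast
qed

text \<open>The reductions need each of the first \<open>N\<close> goods in some bundle; unassigned
  ones join an arbitrary bundle, which nonnegativity allows.\<close>

lemma packing_covering:
  fixes w :: "nat \<Rightarrow> real"
  assumes "has_packing w n UNIV" "n \<ge> 1" "\<And>x. 0 \<le> w x"
  obtains P :: "nat \<Rightarrow> nat set" and J where "finite J" "card J = n" "disjoint_family_on P J"
    "\<And>j. j \<in> J \<Longrightarrow> finite (P j)" "\<And>j. j \<in> J \<Longrightarrow> 1 \<le> sum w (P j)" "{..<N} \<subseteq> \<Union>(P ` J)"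
proof -
  obtain P :: "nat \<Rightarrow> nat set" and J where P: "finite J" "card J = n" "disjoint_family_on P J"
    "\<And>j. j \<in> J \<Longrightarrow> finite (P j)" "\<And>j. j \<in> J \<Longrightarrow> 1 \<le> sum w (P j)"
    using has_packingE[OF assms(1)] by metis
  have "J \<noteq> {}" using P(2) assms(2) by auto
  then obtain j0 where j0: "j0 \<in> J" by blast
  define P' where "P' = P(j0 := P j0 \<union> ({..<N} - \<Union>(P ` J)))"
  show thesis
  proof (rule that[of J P'])
    show "disjoint_family_on P' J"
      using P(3) j0 unfolding P'_def disjoint_family_on_def by auto
    show "finite (P' j)" if "j \<in> J" for j using P(4) that j0 by (auto simp: P'_def)
    show "1 \<le> sum w (P' j)" if "j \<in> J" for j
    proof -
      have "sum w (P j) \<le> sum w (P' j)"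
        by (rule sum_mono2) (use P(4) that j0 assms(3) in \<open>auto simp: P'_def\<close>)
      then show ?thesis using P(5)[OF that] by simp
    qed
    show "{..<N} \<subseteq> \<Union>(P' ` J)" using j0 unfolding P'_def by fastforce
  qed (use P in auto)
qed

text \<open>By pigeonhole some bundle contains at least \<open>r\<close> of the best \<open>(r - 1) * n + 1\<close> goods,
  and these dominate the worst \<open>r\<close> of them.\<close>

lemma reduce_block:
  fixes w :: "nat \<Rightarrow> real"
  assumes "antimono w" "\<And>x. 0 \<le> w x" "has_packing w n UNIV" "n \<ge> 1" "r \<ge> 1" "N = (r - 1) * n + 1"
  shows "has_packing w (n - 1) (- {N-r..<N})"
proof -
  obtain P :: "nat \<Rightarrow> nat set" and J where P: "finite J" "card J = n" "disjoint_family_on P J"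
    "\<And>j. j \<in> J \<Longrightarrow> finite (P j)" "\<And>j. j \<in> J \<Longrightarrow> 1 \<le> sum w (P j)" "{..<N} \<subseteq> \<Union>(P ` J)"
    using packing_covering[OF assms(3,4,2)] by metis
  have "\<exists>j\<in>J. r \<le> card (P j \<inter> {..<N})"
  proof (rule ccontr)
    assume "\<not> ?thesis"
    then have c: "card (P j \<inter> {..<N}) \<le> r - 1" if "j \<in> J" for j using that by force
    have "{..<N} = (\<Union>j\<in>J. P j \<inter> {..<N})" using P(6) by auto
    then have "N \<le> (\<Sum>j\<in>J. card (P j \<inter> {..<N}))" using card_UN_le[OF P(1)] by (metis card_lessThan)
    also have "\<dots> \<le> card J * (r - 1)" using sum_bounded_above[OF c] by simp
    finally show False using P(2) assms(6) by (simp add: mult.commute)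
  qed
  then obtain j0 where j0: "j0 \<in> J" "r \<le> card (P j0 \<inter> {..<N})" by blast
  then obtain h where h: "inj_on h {N-r..<N}" "h ` {N-r..<N} \<subseteq> P j0 \<inter> {..<N}"
    "\<forall>s\<in>{N-r..<N}. h s \<le> s" using dominating_injection[of "P j0 \<inter> {..<N}" N r] by auto
  have "\<exists>Q'. disjoint_family_on Q' (J - {j0}) \<and>
    (\<forall>j\<in>J - {j0}. finite (Q' j) \<and> Q' j \<inter> {N-r..<N} = {} \<and> Q' j \<subseteq> \<Union>(P ` (J - {j0})) \<union> P j0 \<and> sum w (P j) \<le> sum w (Q' j))"
  proof (rule exchange_out[where h = h])
    show "disjoint_family_on P (J - {j0})" using P(3) by (auto simp: disjoint_family_on_def)
    show "P j \<inter> P j0 = {}" if "j \<in> J - {j0}" for j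
      using that P(3) j0(1) by (auto simp: disjoint_family_on_def)
  qed (use assms h P in auto)
  then obtain Q' where Q': "disjoint_family_on Q' (J - {j0})"
    "\<forall>j\<in>J - {j0}. finite (Q' j) \<and> Q' j \<inter> {N-r..<N} = {} \<and> sum w (P j) \<le> sum w (Q' j)" by blast
  show ?thesis
  proof (rule has_packingI[of "J - {j0}" _ Q'])
    show "finite (Q' j) \<and> Q' j \<subseteq> - {N-r..<N} \<and> 1 \<le> sum w (Q' j)" if "j \<in> J - {j0}" for j
      using Q'(2) P(5) that by (meson DiffD1 disjoint_eq_subset_Compl order_trans)
  qed (use P Q' j0 in auto)
qed

text \<open>A bundle containing both goods is discarded. Otherwise the two bundles concerned are
  worth at least 2 and lose at most 3/4 + 1/4 = 1, so their remainders merge into one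
  bundle.\<close>

lemma reduce_first_last:
  fixes w :: "nat \<Rightarrow> real"
  assumes "\<And>x. 0 \<le> w x" "has_packing w n UNIV" "n \<ge> 1" "w 0 \<le> 3/4" "w (2*n) \<le> 1/4"
  shows "has_packing w (n - 1) (- {0, 2*n})"
proof -
  obtain P :: "nat \<Rightarrow> nat set" and J where P: "finite J" "card J = n" "disjoint_family_on P J"
    "\<And>j. j \<in> J \<Longrightarrow> finite (P j)" "\<And>j. j \<in> J \<Longrightarrow> 1 \<le> sum w (P j)" "{..<2*n+1} \<subseteq> \<Union>(P ` J)"
    using packing_covering[OF assms(2,3,1)] by metis
  have "0 \<in> \<Union>(P ` J)" "2*n \<in> \<Union>(P ` J)" using P(6) by auto
  then obtain a b where ab: "a \<in> J" "0 \<in> P a" "b \<in> J" "2*n \<in> P b" by blast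
  note eqI = disjoint_family_on_eq_index[OF P(3)]
  define Q where "Q = (if a = b then P else P(b := (P a - {0}) \<union> (P b - {2*n})))"
  show ?thesis
  proof (rule has_packingI[of "J - {a}" _ Q])
    show "disjoint_family_on Q (J - {a})"
      using P(3) ab unfolding Q_def disjoint_family_on_def by (auto split: if_splits)
    fix j assume j: "j \<in> J - {a}"
    have "j \<noteq> a" "j \<in> J" using j by auto
    have "0 \<notin> P j" using eqI[OF \<open>j \<in> J\<close> ab(1) _ ab(2)] \<open>j \<noteq> a\<close> by blast
    moreover have "2*n \<notin> P j" if "j \<noteq> b" using eqI[OF \<open>j \<in> J\<close> ab(3) _ ab(4)] that by blast
    moreover have "2*n \<notin> P a" if "a \<noteq> b" using eqI[OF ab(1,3) _ ab(4)] that by blast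
    ultimately have "0 \<notin> Q j" "2*n \<notin> Q j"
      unfolding Q_def using \<open>j \<noteq> a\<close> by (cases "a = b"; cases "j = b"; simp)+
    moreover have "finite (Q j)" using j P(4) ab by (auto simp: Q_def)
    moreover have "1 \<le> sum w (Q j)"
    proof (cases "a \<noteq> b \<and> j = b")
      case True
      have "(P a - {0}) \<inter> (P b - {2*n}) = {}" using eqI[of a b] ab True by blast
      then have "sum w (Q j) = sum w (P a - {0}) + sum w (P b - {2*n})"
        using True P(4) ab by (auto simp: Q_def sum.union_disjoint)
      also have "\<dots> = (sum w (P a) - w 0) + (sum w (P b) - w (2*n))"
        using P(4) ab by (simp add: sum_diff1)
      finally show ?thesis using P(5)[of a] P(5)[of b] ab assms(4,5) by simp
    next
      case False
      then show ?thesis using P(5) j by (auto simp: Q_def)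
    qed
    ultimately show "finite (Q j) \<and> Q j \<subseteq> - {0, 2*n} \<and> 1 \<le> sum w (Q j)" by blast
  qed (use P ab in auto)
qed

section \<open>Renumbering, sorting and normalising goods\<close>

text \<open>Used with \<open>e\<close> listing the goods that survive a reduction, so that these are
  again numbered by all natural numbers.\<close>

lemma has_packing_reindex:
  fixes f :: "'a \<Rightarrow> real" and e :: "'b \<Rightarrow> 'a"
  assumes "has_packing f n X" "inj e" "X \<subseteq> range e"
  shows "has_packing (f \<circ> e) n UNIV"
proof -
  obtain P :: "nat \<Rightarrow> 'a set" and J where P: "finite J" "card J = n" "disjoint_family_on P J"
    "\<And>j. j \<in> J \<Longrightarrow> finite (P j)" "\<And>j. j \<in> J \<Longrightarrow> P j \<subseteq> X" "\<And>j. j \<in> J \<Longrightarrow> 1 \<le> sum f (P j)"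
    using has_packingE[OF assms(1)] by metis
  show ?thesis
  proof (rule has_packingI[of J _ "\<lambda>j. e -` P j"])
    show "disjoint_family_on (\<lambda>j. e -` P j) J"
      using P(3) by (auto simp: disjoint_family_on_def)
    fix j assume j: "j \<in> J"
    have "e ` (e -` P j) = P j" using P(5)[OF j] assms(3) by auto
    then have "sum f (P j) = sum (f \<circ> e) (e -` P j)"
      using sum.reindex[of e "e -` P j" f] inj_on_subset[OF assms(2)] by auto
    then show "finite (e -` P j) \<and> e -` P j \<subseteq> UNIV \<and> 1 \<le> sum (f \<circ> e) (e -` P j)"
      using P(4,6)[OF j] finite_vimageI[OF _ assms(2)] by auto
  qed (use P in auto)
qed

lemma sorted_enumeration:
  fixes f :: "'a \<Rightarrow> real"
  assumes "finite M"
  shows "\<exists>g. bij_betw g {..<card M} M \<and> (\<forall>i j. i \<le> j \<longrightarrow> j < card M \<longrightarrow> f (g j) \<le> f (g i))"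
  using assms
proof (induction "card M" arbitrary: M)
  case 0
  then show ?case by (auto simp: bij_betw_def)
next
  case (Suc c)
  have "\<exists>a\<in>M. \<forall>x\<in>M. f a \<le> f x"
    using Suc.hyps(2) Suc.prems arg_min_if_finite[of M f]
    by (metis card.empty nat.distinct(1) not_le_imp_less)
  then obtain a where a: "a \<in> M" "\<And>x. x \<in> M \<Longrightarrow> f a \<le> f x" by blast
  have c: "c = card (M - {a})" using Suc.hyps(2) a(1) Suc.prems by simp
  obtain g where g: "bij_betw g {..<c} (M - {a})" "\<forall>i j. i \<le> j \<longrightarrow> j < c \<longrightarrow> f (g j) \<le> f (g i)"
    using Suc.hyps(1)[OF c] Suc.prems c by auto
  have gin: "g i \<in> M" if "i < c" for i using g(1) that by (auto simp: bij_betw_def)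
  have "bij_betw (g(c := a)) (insert c {..<c}) (insert a (M - {a}))"
    using g(1) by (auto simp: bij_betw_def inj_on_def)
  moreover have "insert c {..<c} = {..<card M}" using Suc.hyps(2) by auto
  moreover have "insert a (M - {a}) = M" using a by auto
  moreover have "f ((g(c := a)) j) \<le> f ((g(c := a)) i)" if "i \<le> j" "j < card M" for i j
    using that g(2) a(2)[OF gin] Suc.hyps(2) by auto
  ultimately show ?case by metis
qed

text \<open>Padding with zeros makes \<open>w\<close> descending on all natural numbers, so that
  positions such as \<open>2*n\<close> exist however few goods there are.\<close>

lemma sorted_values:
  fixes f :: "'a \<Rightarrow> real"
  assumes "finite M" "\<forall>x\<in>M. 0 \<le> f x"
  shows "\<exists>g w. bij_betw g {..<card M} M \<and> antimono w \<and> (\<forall>j. 0 \<le> w j) \<and>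
    (\<forall>j<card M. w j = f (g j)) \<and> (\<forall>j\<ge>card M. w j = 0)"
proof -
  obtain g where g: "bij_betw g {..<card M} M" "\<forall>i j. i \<le> j \<longrightarrow> j < card M \<longrightarrow> f (g j) \<le> f (g i)"
    using sorted_enumeration[OF assms(1)] by blast
  have pos: "0 \<le> f (g i)" if "i < card M" for i
    using g(1) that assms(2) by (auto simp: bij_betw_def)
  have "antimono (\<lambda>j. if j < card M then f (g j) else 0)"
    using g(2) pos by (auto intro!: antimonoI)
  then show ?thesis
    using g(1) pos by (intro exI[of _ g] exI[of _ "\<lambda>j. if j < card M then f (g j) else 0"]) auto
qed

text \<open>Bundles are rescaled to value exactly 1 and the goods sorted anew; the new sequence stays
  below the old one because each of the first \<open>i + 1\<close> new values bounds the \<open>i\<close>-th one from above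
  and one of them comes from an old position \<open>\<ge> i\<close>.\<close>

lemma normalise_packing:
  fixes w :: "nat \<Rightarrow> real"
  assumes w: "antimono w" "\<And>x. 0 \<le> w x" and pack: "has_packing w n UNIV"
  shows "\<exists>w' P J. antimono w' \<and> (\<forall>x. 0 \<le> w' x) \<and> (\<forall>x. w' x \<le> w x) \<and>
    finite (J :: nat set) \<and> card J = n \<and> disjoint_family_on P J \<and> (\<forall>j\<in>J. finite (P j)) \<and>
    (\<forall>j\<in>J. sum w' (P j) = 1) \<and> (\<forall>x. x \<notin> \<Union>(P ` J) \<longrightarrow> w' x = 0)"
proof -
  obtain P :: "nat \<Rightarrow> nat set" and J where P: "finite J" "card J = n" "disjoint_family_on P J"
    "\<And>j. j \<in> J \<Longrightarrow> finite (P j)" "\<And>j. j \<in> J \<Longrightarrow> 1 \<le> sum w (P j)"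
    using has_packingE[OF pack] by metis
  \<comment> \<open>Goods outside all bundles are discarded; the bundles then carry the whole value
    of the new sequence, so that its total is exactly \<open>n\<close>.\<close>
  define M where "M = \<Union>(P ` J)"
  have finM: "finite M" using P by (auto simp: M_def)
  define ix where "ix = (\<lambda>x. THE j. j \<in> J \<and> x \<in> P j)"
  have ix: "ix x = j" if "j \<in> J" "x \<in> P j" for x j
    unfolding ix_def using that disjoint_family_on_eq_index[OF P(3)] by (intro the_equality) auto
  define f where "f = (\<lambda>x. w x / sum w (P (ix x)))"
  have f0: "0 \<le> f x" and fw: "f x \<le> w x" if x: "x \<in> M" for x
  proof -
    obtain j where j: "j \<in> J" "x \<in> P j" using x by (auto simp: M_def)
    have "1 \<le> sum w (P (ix x))" using ix[OF j] P(5)[OF j(1)] by simp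
    moreover from this have "w x * 1 \<le> w x * sum w (P (ix x))"
      by (intro mult_left_mono) (use w in auto)
    ultimately show "0 \<le> f x" "f x \<le> w x" using w(2)[of x] by (auto simp: f_def field_simps)
  qed
  have fsum: "sum f (P j) = 1" if "j \<in> J" for j
  proof -
    have "sum f (P j) = (\<Sum>x\<in>P j. w x / sum w (P j))"
      by (intro sum.cong) (auto simp: f_def ix[OF that])
    also have "\<dots> = sum w (P j) / sum w (P j)" by (rule sum_divide_distrib[symmetric])
    finally show ?thesis using P(5)[OF that] by simp
  qed
  obtain g w' where g: "bij_betw g {..<card M} M" and w': "antimono w'" "\<forall>j. 0 \<le> w' j"
    "\<forall>j<card M. w' j = f (g j)" "\<forall>j\<ge>card M. w' j = 0"
    using sorted_values[OF finM, of f] f0 by blast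
  have gM: "g i \<in> M" if "i < card M" for i using g that by (auto simp: bij_betw_def)
  have le: "w' i \<le> w i" for i
  proof (cases "i < card M")
    case True
    have "\<exists>k\<le>i. i \<le> g k"
    proof (rule ccontr)
      assume "\<not> ?thesis"
      then have "g ` {..i} \<subseteq> {..<i}" by force
      moreover have "inj_on g {..i}"
        using g True by (auto simp: bij_betw_def intro: inj_on_subset)
      ultimately show False using card_inj_on_le[of g "{..i}" "{..<i}"] by simp
    qed
    then obtain k where k: "k \<le> i" "i \<le> g k" by blast
    have "w' i \<le> w' k" using w'(1) k by (auto dest: antimonoD)
    also have "\<dots> = f (g k)" using k True w'(3) by simp
    also have "\<dots> \<le> w (g k)" using fw gM k True by simp
    also have "\<dots> \<le> w i" using w(1) k by (auto dest: antimonoD)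
    finally show ?thesis .
  qed (use w'(4) w(2) in auto)
  define Q where "Q = (\<lambda>j. {i. i < card M \<and> g i \<in> P j})"
  have gQ: "g ` Q j = P j" if "j \<in> J" for j
  proof -
    have "P j \<subseteq> g ` {..<card M}" using g that by (auto simp: bij_betw_def M_def)
    then show ?thesis unfolding Q_def by auto
  qed
  show ?thesis
  proof (intro exI[of _ w'] exI[of _ Q] exI[of _ J] conjI allI ballI impI)
    show "disjoint_family_on Q J" using P(3) by (auto simp: disjoint_family_on_def Q_def)
    show "finite (Q j)" for j by (auto simp: Q_def)
    show "sum w' (Q j) = 1" if "j \<in> J" for j
    proof -
      have "inj_on g (Q j)" using g by (auto simp: bij_betw_def Q_def intro: inj_on_subset)
      then have "sum f (P j) = sum (f \<circ> g) (Q j)" using gQ[OF that] sum.reindex by metis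
      also have "\<dots> = sum w' (Q j)" by (intro sum.cong) (auto simp: Q_def w'(3))
      finally show ?thesis using fsum[OF that] by simp
    qed
    show "w' x = 0" if "x \<notin> \<Union>(Q ` J)" for x
    proof -
      have "\<not> x < card M"
      proof
        assume "x < card M"
        moreover from gM[OF this] obtain j where "j \<in> J" "g x \<in> P j" by (auto simp: M_def)
        ultimately show False using that by (auto simp: Q_def)
      qed
      then show ?thesis using w'(4) by simp
    qed
  qed (use w' P le in auto)
qed

section \<open>The total of the bag caps\<close>

text \<open>The common part cancels, and \<open>c\<close> separates what is left of \<open>L\<close>
  from what is left of \<open>J\<close>.\<close>

lemma sum_diff_le_card_diff:
  fixes w :: "'a \<Rightarrow> real"
  assumes "finite L" "finite J" "\<And>x. x \<in> L \<Longrightarrow> w x \<le> c" "\<And>x. x \<in> J - L \<Longrightarrow> c \<le> w x"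
  shows "sum w L - sum w J \<le> (real (card L) - real (card J)) * c"
proof -
  have "sum w L = sum w (L \<inter> J) + sum w (L - J)" "sum w J = sum w (L \<inter> J) + sum w (J - L)"
    using assms(1,2) sum.Int_Diff[of L w J] sum.Int_Diff[of J w L] by (auto simp: Int_commute)
  moreover have "sum w (L - J) \<le> card (L - J) * c"
    using sum_bounded_above[of "L - J" w c] assms(3) by simp
  moreover have "card (J - L) * c \<le> sum w (J - L)"
    using sum_bounded_below[of "J - L" c w] assms(4) by simp
  moreover have "real (card L) = card (L \<inter> J) + card (L - J)" "real (card J) = card (L \<inter> J) + card (J - L)"
    using card_Int_Diff[OF assms(1), of J] card_Int_Diff[OF assms(2), of L] by (auto simp: Int_commute)
  ultimately show ?thesis by (simp add: algebra_simps)
qed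

text \<open>Only bags worth more than 1 can spoil the bound. Let \<open>s\<close> be the last of them. The goods
  \<open>0, \<dots>, s\<close> then lie in different bundles, and the goods \<open>s + 1, \<dots>, 2n - 1 - s\<close> in the
  other \<open>n - s - 1\<close> bundles; the excess of the bags up to \<open>s\<close> is at most \<open>1/8\<close> for every
  partner good (the set \<open>A\<close>) that is squeezed into these other bundles as well, and each such
  good lowers the value of the bags after \<open>s\<close> by more than \<open>1/4\<close>.\<close>

lemma sum_bag_caps_le:
  fixes w :: "nat \<Rightarrow> real"
  assumes w: "antimono w" "\<And>x. 0 \<le> w x"
    and J: "finite (J :: nat set)" "card J = n" and P: "disjoint_family_on P J"
    "\<And>j. j \<in> J \<Longrightarrow> finite (P j)" "\<And>j. j \<in> J \<Longrightarrow> sum w (P j) = 1"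
    and out: "\<And>x. x \<notin> \<Union>(P ` J) \<Longrightarrow> w x = 0"
    and irr: "w 0 + w (2*n) \<le> 3/4" "w (n-1) + w n \<le> 3/4" "w (2*n) \<le> 1/4"
  defines "b \<equiv> \<lambda>k. w k + w (2*n-1-k)"
  defines "cap \<equiv> \<lambda>k. if 3/4 \<le> b k then b k else 3/4 + w (2*n)"
  shows "sum cap {..<n} \<le> n"
proof (cases "\<exists>k<n. b k > 1")
  case False
  have "cap k \<le> 1" if "k \<in> {..<n}" for k
  proof -
    have "b k \<le> 1" using False that by (meson lessThan_iff not_le)
    then show ?thesis using irr(3) by (simp add: cap_def)
  qed
  then have "sum cap {..<n} \<le> of_nat (card {..<n}) * 1" by (rule sum_bounded_above)
  then show ?thesis by simp
next
  case True
  define y where "y = (\<lambda>k. w (2*n-1-k))"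
  define s where "s = Max {k. k < n \<and> b k > 1}"
  have "s \<in> {k. k < n \<and> b k > 1}" unfolding s_def using True by (intro Max_in) auto
  then have s: "s < n" "b s > 1" by auto
  have smax: "b k \<le> 1" if "s < k" "k < n" for k
  proof (rule ccontr)
    assume "\<not> b k \<le> 1"
    then have "k \<le> s" unfolding s_def using that by (intro Max_ge) auto
    then show False using that by simp
  qed
  have mono: "w i \<le> w j" if "j \<le> i" for i j using w(1) that by (auto dest: antimonoD)
  have "n \<le> 2*n-1-s" using s(1) by simp
  then have ys: "y s \<le> 3/8"
    using mono[of n "2*n-1-s"] mono[of "n-1" n] irr(2) unfolding y_def by simp
  have wys: "w s + y s > 1" using s(2) by (simp add: b_def y_def)
  then have ws: "w s > 5/8" using ys by simp
  \<comment> \<open>Since \<open>w s \<le> w 0 \<le> 3/4 - w (2*n)\<close>. The margin over 1/4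
    later absorbs the term \<open>w (2*n)\<close> in the caps after \<open>s\<close>.\<close>
  have ys4: "y s > 1/4 + w (2*n)" using wys mono[of 0 s] irr(1) by simp
  have ymono: "y i \<le> y j" if "i \<le> j" for i j unfolding y_def using that by (intro mono) simp
  define \<beta> where "\<beta> = (\<lambda>x. SOME j. j \<in> J \<and> x \<in> P j)"
  have \<beta>: "\<beta> x \<in> J \<and> x \<in> P (\<beta> x)" if "w x > 0" for x
  proof -
    have "x \<in> \<Union>(P ` J)" using out[of x] that by fastforce
    then have "\<exists>j. j \<in> J \<and> x \<in> P j" by blast
    then show ?thesis unfolding \<beta>_def by (rule someI_ex)
  qed
  have \<beta>sum: "sum w X \<le> 1" if "finite X" "\<And>x. x \<in> X \<Longrightarrow> w x > 0 \<and> \<beta> x = j" for X j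
  proof (cases "X = {}")
    case False
    then have "j \<in> J" "X \<subseteq> P j" using that(2) \<beta> by blast+
    then have "sum w X \<le> sum w (P j)" using P(2) w(2) by (intro sum_mono2) auto
    then show ?thesis using P(3) \<open>j \<in> J\<close> by simp
  qed simp
  have incompat: "\<beta> a \<noteq> \<beta> c" if "w a > 0" "w c > 0" "a \<noteq> c" "w a + w c > 1" for a c
  proof
    assume "\<beta> a = \<beta> c"
    then have "sum w {a,c} \<le> 1" using that by (intro \<beta>sum[of _ "\<beta> a"]) auto
    then show False using that by simp
  qed
  have big: "w k > 5/8" if "k \<le> s" for k using mono[OF that] ws by simp
  define T where "T = \<beta> ` {..s}"
  have injT: "inj_on \<beta> {..s}"
  proof (rule inj_onI)
    fix a c assume "a \<in> {..s}" "c \<in> {..s}" "\<beta> a = \<beta> c"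
    then show "a = c" using big[of a] big[of c] incompat[of a c] by auto
  qed
  have T: "T \<subseteq> J" "card T = s + 1"
  proof -
    show "T \<subseteq> J" unfolding T_def using \<beta> big by force
    show "card T = s + 1" unfolding T_def using card_image[OF injT] by simp
  qed
  define U where "U = J - T"
  have cardU: "card U = n - (s + 1)" unfolding U_def using T J by (simp add: card_Diff_subset finite_subset)
  have midU: "w g > 0 \<and> \<beta> g \<in> U" if "s < g" "g \<le> 2*n-1-s" for g
  proof -
    have g: "w g \<ge> y s" unfolding y_def using that by (intro mono)
    then have g0: "w g > 0" using ys4 w(2)[of "2*n"] by simp
    have "\<beta> g \<noteq> \<beta> a" if "a \<le> s" for a
      using incompat[of g a] big[OF that] g g0 mono[OF that] wys \<open>s < g\<close> that by auto
    then show ?thesis using \<beta>[OF g0] g0 by (auto simp: U_def T_def)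
  qed
  \<comment> \<open>As \<open>w k \<le> 3/4\<close>, a bag up to \<open>s\<close> can exceed 1 only
    if its partner good is worth more than 1/4. For \<open>k\<close> in \<open>L'\<close> the
    partner shares a bundle with one of the goods \<open>0, ..., s\<close>; for \<open>k\<close> in
    \<open>A\<close> it does not.\<close>
  define L where "L = {k. k \<le> s \<and> y k > 1/4}"
  define A where "A = {k \<in> L. \<beta> (2*n-1-k) \<in> U}"
  define L' where "L' = L - A"
  have fin: "finite L" "finite A" "finite L'" by (auto simp: L_def A_def L'_def)
  have AL: "A \<subseteq> L" by (auto simp: A_def)
  have pos: "w (2*n-1-k) > 1/4" if "k \<in> L" for k using that by (simp add: L_def y_def)

  define X where "X = {s+1..<n} \<union> (\<lambda>k. 2*n-1-k) ` ({s+1..<n} \<union> A)"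
  have injr: "inj_on (\<lambda>k. 2*n-1-k) ({s+1..<n} \<union> A)"
    using s(1) by (auto simp: inj_on_def A_def L_def)
  have "sum w X = sum w {s+1..<n} + sum y ({s+1..<n} \<union> A)"
  proof -
    have "{s+1..<n} \<inter> (\<lambda>k. 2*n-1-k) ` ({s+1..<n} \<union> A) = {}"
      using s(1) by (auto simp: A_def L_def)
    then have "sum w X = sum w {s+1..<n} + sum w ((\<lambda>k. 2*n-1-k) ` ({s+1..<n} \<union> A))"
      unfolding X_def using fin by (intro sum.union_disjoint) auto
    also have "sum w ((\<lambda>k. 2*n-1-k) ` ({s+1..<n} \<union> A)) = sum y ({s+1..<n} \<union> A)"
      using sum.reindex[OF injr, of w] by (simp add: y_def comp_def)
    finally show ?thesis .
  qed
  also have "sum y ({s+1..<n} \<union> A) = sum y {s+1..<n} + sum y A"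
    using fin by (intro sum.union_disjoint) (auto simp: A_def L_def)
  finally have sumX: "sum w X = sum b {s+1..<n} + sum y A"
    by (simp add: b_def y_def sum.distrib)
  have XU: "w x > 0 \<and> \<beta> x \<in> U" if "x \<in> X" for x
    using that unfolding X_def
  proof (elim UnE imageE)
    fix k assume "k \<in> A" "x = 2*n-1-k"
    then show ?thesis using pos[of k] AL by (auto simp: A_def)
  qed (use midU s(1) in auto)
  have "sum w X = (\<Sum>j\<in>U. sum w {x\<in>X. \<beta> x = j})"
    using XU fin J by (intro sum.group[symmetric]) (auto simp: X_def U_def)
  also have "\<dots> \<le> of_nat (card U) * 1"
    using XU fin by (intro sum_bounded_above \<beta>sum) (auto simp: X_def)
  finally have sumb: "sum b {s+1..<n} + sum y A \<le> n - (s + 1)" using cardU sumX by simp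
  have "sum y A \<ge> of_nat (card A) * (1/4)"
    by (intro sum_bounded_below) (auto simp: A_def L_def)
  then have sumb': "sum b {s+1..<n} \<le> real (n - (s + 1)) - card A / 4" using sumb by simp
  \<comment> \<open>Averaging with 1 turns the loss \<open>card A / 4\<close> into
    \<open>card A / 8\<close>. It is valid for a bag below 3/4 because both its goods are worth at
    least \<open>y s\<close>, whence \<open>b k > 1/2 + 2 * w (2*n)\<close>.\<close>
  have "cap k \<le> (1 + b k) / 2" if "k \<in> {s+1..<n}" for k
  proof -
    have "b k \<le> 1" using smax that by auto
    moreover have "w k \<ge> y s" unfolding y_def using that s(1) by (intro mono) auto
    moreover have "y k \<ge> y s" using that by (intro ymono) auto
    ultimately show ?thesis using ys4 unfolding cap_def b_def y_def by auto
  qed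
  then have "sum cap {s+1..<n} \<le> (\<Sum>k\<in>{s+1..<n}. (1 + b k) / 2)" by (rule sum_mono)
  also have "\<dots> = (real (n - (s + 1)) + sum b {s+1..<n}) / 2"
    by (simp add: sum_divide_distrib[symmetric] sum.distrib)
  finally have part3: "sum cap {s+1..<n} \<le> real (n - (s + 1)) - card A / 8" using sumb' by simp

  \<comment> \<open>\<open>\<phi> k\<close> is the good among \<open>0, ..., s\<close> in the bundle
    of the partner of \<open>k\<close>; the bundle total 1 bounds \<open>y k\<close> by
    \<open>1 - w (\<phi> k)\<close>.\<close>
  define \<phi> where "\<phi> = (\<lambda>k. SOME a. a \<le> s \<and> \<beta> a = \<beta> (2*n-1-k))"
  have \<phi>: "\<phi> k \<le> s \<and> \<beta> (\<phi> k) = \<beta> (2*n-1-k)" if "k \<in> L'" for k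
  proof -
    have "w (2*n-1-k) > 0" using that pos[of k] by (auto simp: L'_def)
    then have "\<beta> (2*n-1-k) \<in> T" using that \<beta> by (auto simp: L'_def A_def U_def)
    then have "\<exists>a. a \<le> s \<and> \<beta> a = \<beta> (2*n-1-k)" by (auto simp: T_def)
    then show ?thesis unfolding \<phi>_def by (rule someI_ex)
  qed
  have ne: "\<phi> k \<noteq> 2*n-1-l" if "k \<in> L'" "l \<in> L'" for k l
    using \<phi>[OF that(1)] that(2) s(1) by (auto simp: L'_def L_def)
  have yphi: "y k \<le> 1 - w (\<phi> k)" if "k \<in> L'" for k
  proof -
    have "sum w {\<phi> k, 2*n-1-k} \<le> 1"
      using \<phi>[OF that] big[of "\<phi> k"] pos[of k] that by (intro \<beta>sum[of _ "\<beta> (\<phi> k)"]) (auto simp: L'_def)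
    then show ?thesis using ne[OF that that] by (simp add: y_def)
  qed
  \<comment> \<open>Two partners in one bundle with a good from \<open>0, ..., s\<close> would be
    worth more than 5/8 + 1/4 + 1/4 > 1.\<close>
  have inj\<phi>: "inj_on \<phi> L'"
  proof (rule inj_onI, rule ccontr)
    fix k l assume kl: "k \<in> L'" "l \<in> L'" "\<phi> k = \<phi> l" "k \<noteq> l"
    have d: "2*n-1-k \<noteq> 2*n-1-l" using kl s(1) by (auto simp: L'_def L_def)
    have "sum w {\<phi> k, 2*n-1-k, 2*n-1-l} \<le> 1"
      using \<phi>[OF kl(1)] \<phi>[OF kl(2)] kl big[of "\<phi> k"] pos[of k] pos[of l]
      by (intro \<beta>sum[of _ "\<beta> (\<phi> k)"]) (auto simp: L'_def)
    then have "w (\<phi> k) + w (2*n-1-k) + w (2*n-1-l) \<le> 1"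
      using ne[OF kl(1) kl(1)] ne[OF kl(1) kl(2)] d by simp
    then show False using \<phi>[OF kl(1)] kl(1,2) big[of "\<phi> k"] pos[of k] pos[of l] by (auto simp: L'_def)
  qed
  have capL: "cap k = w k + y k" if "k \<in> L" for k
    using that big[of k] by (auto simp: L_def cap_def b_def y_def)
  have cardL: "card L = card L' + card A"
    unfolding L'_def using AL fin by (simp add: card_Diff_subset card_mono)
  have "sum y A \<le> of_nat (card A) * (3/8)"
    using ymono ys by (intro sum_bounded_above) (force simp: A_def L_def)
  moreover have "sum y L' \<le> real (card L') - sum w (\<phi> ` L')"
    using sum_mono[OF yphi] sum.reindex[OF inj\<phi>, of w] by (simp add: sum_subtractf)
  moreover have "sum w L - sum w (\<phi> ` L') \<le> card A * (3/4)"
  proof (cases "L = {}")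
    case False
    \<comment> \<open>\<open>L\<close> is an upper segment of \<open>{..s}\<close> because
      \<open>y\<close> increases, so \<open>w (Min L)\<close> separates the values on
      \<open>L\<close> from those at the other indices up to \<open>s\<close>.\<close>
    define c where "c = w (Min L)"
    have m: "Min L \<in> L" "\<And>k. k \<in> L \<Longrightarrow> Min L \<le> k" using False fin by auto
    have "sum w L - sum w (\<phi> ` L') \<le> (real (card L) - real (card (\<phi> ` L'))) * c"
    proof (rule sum_diff_le_card_diff)
      fix a assume a: "a \<in> \<phi> ` L' - L"
      have "a \<le> Min L"
      proof (rule ccontr)
        assume "\<not> a \<le> Min L"
        then have "y a > 1/4" using m(1) ymono[of "Min L" a] by (auto simp: L_def)
        then show False using a \<phi> by (auto simp: L_def)
      qed
      then show "c \<le> w a" unfolding c_def by (rule mono)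
    qed (use fin m in \<open>auto simp: c_def intro: mono\<close>)
    also have "real (card L) - real (card (\<phi> ` L')) = card A" using cardL card_image[OF inj\<phi>] by simp
    also have "card A * c \<le> card A * (3/4)"
      using mono[of 0 "Min L"] irr(1) w(2)[of "2*n"] by (intro mult_left_mono) (auto simp: c_def)
    finally show ?thesis .
  qed (use AL in \<open>auto simp: L'_def\<close>)
  moreover have "sum cap L = sum w L + (sum y L' + sum y A)"
  proof -
    have "sum y L = sum y L' + sum y A"
      unfolding L'_def using AL fin by (simp add: sum.subset_diff)
    then show ?thesis using capL by (simp add: sum.distrib)
  qed
  \<comment> \<open>An element of \<open>L'\<close> contributes 1 and one of \<open>A\<close>
    contributes 3/4 + 3/8 = 1 + 1/8; the surplus 1/8 cancels against the bags after
    \<open>s\<close>.\<close>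
  ultimately have part2: "sum cap L \<le> card L + card A / 8" using cardL by simp

  have part1: "sum cap ({..s} - L) \<le> of_nat (card ({..s} - L)) * 1"
  proof (rule sum_bounded_above)
    fix k assume "k \<in> {..s} - L"
    then have "k \<le> s" "y k \<le> 1/4" by (auto simp: L_def)
    then have "b k \<le> 1" using mono[of 0 k] irr(1) w(2)[of "2*n"] by (simp add: b_def y_def)
    then show "cap k \<le> 1" using irr(3) by (simp add: cap_def)
  qed
  have Ls: "L \<subseteq> {..s}" by (auto simp: L_def)
  have "{..<n} = {..s} \<union> {s+1..<n}" "{..s} \<inter> {s+1..<n} = {}" using s(1) by auto
  then have "sum cap {..<n} = sum cap {..s} + sum cap {s+1..<n}"
    using sum.union_disjoint[of "{..s}" "{s+1..<n}" cap] by simp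
  also have "sum cap {..s} = sum cap ({..s} - L) + sum cap L" using Ls by (intro sum.subset_diff) auto
  also have "\<dots> \<le> real (card ({..s} - L)) + card L + card A / 8" using part1 part2 by simp
  also have "real (card ({..s} - L)) + card L = s + 1"
    using card_mono[OF _ Ls] fin Ls by (simp add: card_Diff_subset of_nat_diff)
  finally have "sum cap {..<n} \<le> real (s + 1) + real (n - (s + 1))" using part3 by simp
  then show ?thesis using s(1) by simp
qed

section \<open>Bag filling and the 3/4 theorem\<close>

lemma allocation_insert:
  assumes "i \<in> N" "disjoint_family_on A (N - {i})" "\<And>l. l \<in> N - {i} \<Longrightarrow> A l \<inter> S = {}"
  shows "disjoint_family_on (A(i := S)) N"
  using assms unfolding disjoint_family_on_def by (auto simp: Int_commute)

text \<open>The hypothesis \<open>enough\<close> is invariant: a bag that is filled up with as few goods as possible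
  costs no remaining agent more than her cap for this bag.\<close>

lemma bag_filling:
  fixes v :: "'i \<Rightarrow> 'a \<Rightarrow> real" and B :: "'k \<Rightarrow> 'a set"
  assumes "finite N" "finite K" "card K = card N" "finite R" "disjoint_family_on B K"
    "\<And>k. k \<in> K \<Longrightarrow> finite (B k) \<and> B k \<inter> R = {}"
    "\<And>i x. i \<in> N \<Longrightarrow> 0 \<le> v i x"
    and small: "\<And>i x. i \<in> N \<Longrightarrow> x \<in> R \<Longrightarrow> v i x \<le> \<epsilon> i" and "\<And>i. i \<in> N \<Longrightarrow> 0 \<le> \<epsilon> i"
    and cap: "\<And>i k. cap i k = (if 3/4 \<le> sum (v i) (B k) then sum (v i) (B k) else 3/4 + \<epsilon> i)"
    and enough: "\<And>i. i \<in> N \<Longrightarrow> (\<Sum>k\<in>K. cap i k) \<le> sum (v i) R + (\<Sum>k\<in>K. sum (v i) (B k))"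
  shows "\<exists>A. disjoint_family_on A N \<and>
    (\<forall>i\<in>N. finite (A i) \<and> A i \<subseteq> R \<union> \<Union>(B ` K) \<and> 3/4 \<le> sum (v i) (A i))"
  using assms
proof (induction "card N" arbitrary: N K R)
  case 0
  then show ?case by (auto simp: disjoint_family_on_def)
next
  case (Suc r)
  have capb: "sum (v i) (B k) \<le> cap i k" "3/4 \<le> cap i k" if "i \<in> N" for i k
    using Suc.prems(9)[OF that] cap[of i k] by auto
  have "N \<noteq> {}" "K \<noteq> {}" using Suc.hyps(2) Suc.prems(3) by auto
  then obtain i0 k where i0: "i0 \<in> N" and k: "k \<in> K" by blast
  define ok where "ok = (\<lambda>F. F \<subseteq> R \<and> (\<exists>i\<in>N. 3/4 \<le> sum (v i) (B k \<union> F)))"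
  have split: "sum (v i) (B k \<union> F) = sum (v i) (B k) + sum (v i) F" if "F \<subseteq> R" for i F
    using Suc.prems(6)[OF k] finite_subset[OF that Suc.prems(4)] that by (intro sum.union_disjoint) auto
  have remK: "(\<Sum>l\<in>K. f l) = f k + (\<Sum>l\<in>K-{k}. f l)" for f :: "'k \<Rightarrow> real"
    using Suc.prems(2) k by (rule sum.remove)
  \<comment> \<open>The other bags are worth at most their caps, so \<open>enough\<close> leaves
    \<open>B k \<union> R\<close> worth at least the cap of \<open>k\<close>, hence at least
    3/4.\<close>
  have "ok R"
  proof -
    have "(\<Sum>l\<in>K-{k}. sum (v i0) (B l)) \<le> (\<Sum>l\<in>K-{k}. cap i0 l)"
      by (rule sum_mono) (rule capb[OF i0])
    then have "3/4 \<le> sum (v i0) (B k \<union> R)"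
      using Suc.prems(11)[OF i0] capb(2)[OF i0, of k] split[of R i0] by (simp add: remK)
    then show ?thesis using i0 by (auto simp: ok_def)
  qed
  then obtain F where F: "ok F" "\<And>F'. ok F' \<Longrightarrow> card F \<le> card F'"
    using ex_has_least_nat[of ok R card] by blast
  obtain i where i: "i \<in> N" "3/4 \<le> sum (v i) (B k \<union> F)" and FR: "F \<subseteq> R" using F(1) by (auto simp: ok_def)
  have finF: "finite F" using FR Suc.prems(4) finite_subset by blast
  have cost: "sum (v l) (B k \<union> F) \<le> cap l k" if l: "l \<in> N" for l
  proof (cases "F = {}")
    case True
    then show ?thesis using capb(1)[OF l] by simp
  next
    case False
    then obtain x where x: "x \<in> F" by blast
    \<comment> \<open>By minimality no smaller filling satisfies any agent, so \<open>l\<close>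
      values the bag below 3/4 before its last good, which adds at most
      \<open>\<epsilon> l\<close>.\<close>
    have low: "sum (v l) (B k \<union> F') < 3/4" if "F' \<subset> F" for F'
    proof (rule ccontr)
      assume "\<not> ?thesis"
      then have "ok F'" using that FR l by (force simp: ok_def)
      then show False using F(2) psubset_card_mono[OF finF that] by force
    qed
    have "sum (v l) (B k) < 3/4" using low[of "{}"] False by auto
    moreover have "F - {x} \<subseteq> R" using FR by auto
    then have "sum (v l) (B k \<union> F) = sum (v l) (B k \<union> (F - {x})) + v l x"
      using split[OF FR, of l] split[of "F - {x}" l] sum.remove[OF finF x, of "v l"] by simp
    moreover have "sum (v l) (B k \<union> (F - {x})) < 3/4" using x by (intro low) auto
    moreover have "v l x \<le> \<epsilon> l" using small l x FR Suc.prems(8) by blast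
    ultimately show ?thesis using cap[of l k] by auto
  qed
  have "\<exists>A. disjoint_family_on A (N - {i}) \<and>
    (\<forall>l\<in>N - {i}. finite (A l) \<and> A l \<subseteq> (R - F) \<union> \<Union>(B ` (K - {k})) \<and> 3/4 \<le> sum (v l) (A l))"
  proof (rule Suc.hyps(1))
    show "r = card (N - {i})" using Suc.hyps(2) i Suc.prems(1) by simp
    show "card (K - {k}) = card (N - {i})" using Suc.prems(1,2,3) i k by simp
    show "disjoint_family_on B (K - {k})" using Suc.prems(5) by (auto simp: disjoint_family_on_def)
    fix l assume l: "l \<in> N - {i}"
    have "sum (v l) R = sum (v l) F + sum (v l) (R - F)"
      using sum.subset_diff[OF FR Suc.prems(4), of "v l"] by simp
    then show "(\<Sum>k\<in>K-{k}. cap l k) \<le> sum (v l) (R - F) + (\<Sum>k\<in>K-{k}. sum (v l) (B k))"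
      using Suc.prems(11)[of l] cost[of l] split[OF FR, of l] l by (simp add: remK)
  qed (use Suc.prems in auto)
  then obtain A where A: "disjoint_family_on A (N - {i})"
    "\<And>l. l \<in> N - {i} \<Longrightarrow> finite (A l) \<and> A l \<subseteq> (R - F) \<union> \<Union>(B ` (K - {k})) \<and> 3/4 \<le> sum (v l) (A l)"
    by blast
  have disj: "(B k \<union> F) \<inter> ((R - F) \<union> \<Union>(B ` (K - {k}))) = {}"
  proof -
    have "B k \<inter> R = {}" using Suc.prems(6) k by blast
    moreover have "B k \<inter> B l = {}" if "l \<in> K - {k}" for l
      using Suc.prems(5) k that unfolding disjoint_family_on_def by blast
    moreover have "F \<inter> B l = {}" if "l \<in> K - {k}" for l
      using Suc.prems(6)[of l] that FR by blast
    ultimately show ?thesis by blast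
  qed
  show ?case
  proof (intro exI[of _ "A(i := B k \<union> F)"] conjI ballI)
    show "disjoint_family_on (A(i := B k \<union> F)) N"
      using i(1) A(1)
    proof (rule allocation_insert)
      show "A l \<inter> (B k \<union> F) = {}" if "l \<in> N - {i}" for l using A(2)[OF that] disj by blast
    qed
    fix l assume l: "l \<in> N"
    show "finite ((A(i := B k \<union> F)) l)" "3/4 \<le> sum (v l) ((A(i := B k \<union> F)) l)"
      using A(2)[of l] l i finF Suc.prems(6)[OF k] by auto
    show "(A(i := B k \<union> F)) l \<subseteq> R \<union> \<Union>(B ` K)"
      using A(2)[of l] l FR k by auto
  qed
qed

section \<open>The 3/4 theorem, for ordered and then for general values\<close>

text \<open>Induction on the number of agents. If some agent values \<open>{0}\<close>,
  \<open>{n-1,n}\<close>, \<open>{2*n-2,2*n-1,2*n}\<close> or \<open>{0,2*n}\<close> at 3/4 or more,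
  she leaves with it and the others keep enough bundles; the last set is treated once the first and
  third are excluded. If nobody does, the failed reductions give the inequalities required by
  \<open>sum_bag_caps_le\<close>.\<close>

lemma ordered_three_quarters_mms:
  fixes w :: "'i \<Rightarrow> nat \<Rightarrow> real"
  assumes "finite N" "\<And>i. i \<in> N \<Longrightarrow> antimono (w i)" "\<And>i x. i \<in> N \<Longrightarrow> 0 \<le> w i x"
    "\<And>i. i \<in> N \<Longrightarrow> has_packing (w i) (card N) UNIV"
  shows "\<exists>A. disjoint_family_on A N \<and> (\<forall>i\<in>N. finite (A i) \<and> 3/4 \<le> sum (w i) (A i))"
  using assms
proof (induction "card N" arbitrary: N w)
  case 0
  then show ?case by (auto simp: disjoint_family_on_def)
next
  case (Suc n')
  define n where "n = card N"
  have n: "n \<ge> 1" "n' = n - 1" using Suc.hyps(2) by (auto simp: n_def)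
  have mono: "w i x \<le> w i y" if "i \<in> N" "y \<le> x" for i x y
    using Suc.prems(2) that by (auto dest: antimonoD)
  have reduce: ?case if i: "i \<in> N" and S: "finite S" "3/4 \<le> sum (w i) S"
    and pack: "\<And>l. l \<in> N \<Longrightarrow> has_packing (w l) (n - 1) (- S)" for i S
  proof -
    define e where "e = enumerate (- S)"
    have inf: "infinite (- S)" using S(1) by (simp add: Compl_eq_Diff_UNIV)
    have e: "strict_mono e" "range e = - S"
      using strict_mono_enumerate[OF inf] range_enumerate[OF inf] by (auto simp: e_def)
    have inje: "inj e" using e(1) strict_mono_imp_inj_on by blast
    have "\<exists>A. disjoint_family_on A (N - {i}) \<and>
      (\<forall>l\<in>N - {i}. finite (A l) \<and> 3/4 \<le> sum (w l \<circ> e) (A l))"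
    proof (rule Suc.hyps(1))
      show c: "n' = card (N - {i})" using Suc.hyps(2) i Suc.prems(1) by simp
      fix l assume l: "l \<in> N - {i}"
      show "antimono (w l \<circ> e)"
        using l mono strict_mono_leD[OF e(1)] by (auto intro!: antimonoI)
      have "has_packing (w l \<circ> e) (n - 1) UNIV"
        using has_packing_reindex[OF pack inje] l e(2) by auto
      then show "has_packing (w l \<circ> e) (card (N - {i})) UNIV" using c n by simp
    qed (use Suc.prems in auto)
    then obtain A where A: "disjoint_family_on A (N - {i})"
      "\<And>l. l \<in> N - {i} \<Longrightarrow> finite (A l) \<and> 3/4 \<le> sum (w l \<circ> e) (A l)" by blast
    have "disjoint_family_on (\<lambda>l. e ` A l) (N - {i})"
      using A(1) inje unfolding disjoint_family_on_def by (metis image_Int image_empty)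
    then have "disjoint_family_on ((\<lambda>l. e ` A l)(i := S)) N"
      using i e(2) by (intro allocation_insert) auto
    moreover have "sum (w l) (e ` A l) = sum (w l \<circ> e) (A l)" for l
      using inje by (intro sum.reindex) (auto intro: inj_on_subset)
    ultimately show ?thesis using A(2) S by (intro exI[of _ "(\<lambda>l. e ` A l)(i := S)"]) auto
  qed
  note block = reduce_block[OF Suc.prems(2) Suc.prems(3) Suc.prems(4)[folded n_def] n(1)]
  show ?case
  proof (rule ccontr)
    assume contra: "\<not> ?case"
    have irr1: "w i 0 < 3/4" if i: "i \<in> N" for i
    proof (rule ccontr)
      assume "\<not> ?thesis"
      then show False using contra reduce[OF i, of "{1-1..<1}"] block[of _ 1 1] by auto
    qed
    have irr2: "w i (n-1) + w i n < 3/4" if i: "i \<in> N" for i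
    proof (rule ccontr)
      assume "\<not> ?thesis"
      moreover have "{n+1-2..<n+1} = {n-1,n}" using n by auto
      ultimately show False using contra reduce[OF i, of "{n+1-2..<n+1}"] block[of _ 2 "n+1"] n by auto
    qed
    have irr3: "w i (2*n) \<le> 1/4" if i: "i \<in> N" for i
    proof (rule ccontr)
      assume a: "\<not> ?thesis"
      have "{2*n+1-3..<2*n+1} = {2*n-2,2*n-1,2*n}" using n by auto
      moreover have "3/4 \<le> sum (w i) {2*n-2,2*n-1,2*n}"
      proof -
        have "2*n-2 \<noteq> 2*n-1" "2*n-2 \<noteq> 2*n" "2*n-1 \<noteq> 2*n" using n(1) by auto
        then show ?thesis
          using a mono[OF i, of "2*n-2" "2*n"] mono[OF i, of "2*n-1" "2*n"] by simp
      qed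
      ultimately show False
        using contra reduce[OF i, of "{2*n+1-3..<2*n+1}"] block[of _ 3 "2*n+1"] n by auto
    qed
    have irr4: "w i 0 + w i (2*n) < 3/4" if i: "i \<in> N" for i
    proof (rule ccontr)
      assume a: "\<not> ?thesis"
      have "has_packing (w l) (n - 1) (- {0, 2*n})" if l: "l \<in> N" for l
        using irr1[OF l] irr3[OF l] Suc.prems(3)[OF l] Suc.prems(4)[OF l] n
        by (intro reduce_first_last) (auto simp: n_def)
      then show False using contra reduce[OF i, of "{0,2*n}"] a n(1) by auto
    qed
    have "\<exists>w' P J. antimono w' \<and> (\<forall>x. 0 \<le> w' x) \<and> (\<forall>x. w' x \<le> w i x) \<and>
        finite (J :: nat set) \<and> card J = n \<and> disjoint_family_on P J \<and> (\<forall>j\<in>J. finite (P j)) \<and>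
        (\<forall>j\<in>J. sum w' (P j) = 1) \<and> (\<forall>x. x \<notin> \<Union>(P ` J) \<longrightarrow> w' x = 0)" if i: "i \<in> N" for i
      using normalise_packing[OF Suc.prems(2)[OF i] Suc.prems(3)[OF i] Suc.prems(4)[OF i]]
      unfolding n_def .
    \<comment> \<open>Normalised values lie below the old ones: the bounds just proved persist, and
      a set worth 3/4 under \<open>v\<close> is worth at least that under \<open>w\<close>.\<close>
    then obtain v P J where v: "\<forall>i\<in>N. antimono (v i) \<and> (\<forall>x. 0 \<le> v i x) \<and> (\<forall>x. v i x \<le> w i x) \<and>
        finite (J i :: nat set) \<and> card (J i) = n \<and> disjoint_family_on (P i) (J i) \<and>
        (\<forall>j\<in>J i. finite (P i j)) \<and> (\<forall>j\<in>J i. sum (v i) (P i j) = 1) \<and>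
        (\<forall>x. x \<notin> \<Union>(P i ` J i) \<longrightarrow> v i x = 0)" by metis
    have "finite (\<Union>i\<in>N. \<Union>(P i ` J i))" using v Suc.prems(1) by blast
    then obtain m where m: "(\<Union>i\<in>N. \<Union>(P i ` J i)) \<subseteq> {..<m}" using finite_nat_iff_bounded by blast
    define B where "B = (\<lambda>k. {k, 2*n-1-k})"
    \<comment> \<open>Bags and \<open>R\<close> together cover all bundles of all agents, so each
      agent finds her whole value \<open>n\<close> there to compare with the caps.\<close>
    define R where "R = {2*n..<2*n+m}"
    have sumB: "sum (v i) (B k) = v i k + v i (2*n-1-k)" if "k < n" for i k
      using that by (auto simp: B_def)
    have "\<exists>A. disjoint_family_on A N \<and>
      (\<forall>i\<in>N. finite (A i) \<and> A i \<subseteq> R \<union> \<Union>(B ` {..<n}) \<and> 3/4 \<le> sum (v i) (A i))"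
    proof (rule bag_filling[where \<epsilon> = "\<lambda>i. v i (2*n)"])
      show disB: "disjoint_family_on B {..<n}" by (auto simp: disjoint_family_on_def B_def)
      fix i assume i: "i \<in> N"
      note vi = v[rule_format, OF i]
      show "v i x \<le> v i (2*n)" if "x \<in> R" for x
        using vi that by (auto simp: R_def dest: antimonoD)
      have "(\<Sum>k<n. if 3/4 \<le> v i k + v i (2*n-1-k) then v i k + v i (2*n-1-k) else 3/4 + v i (2*n)) \<le> n"
      proof (rule sum_bag_caps_le[where P = "P i" and J = "J i"])
        show "v i 0 + v i (2*n) \<le> 3/4" "v i (n-1) + v i n \<le> 3/4" "v i (2*n) \<le> 1/4"
          using vi irr4[OF i] irr2[OF i] irr3[OF i] by (meson add_mono less_imp_le order_trans)+
      qed (use vi in auto)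
      also have "real n = (\<Sum>j\<in>J i. sum (v i) (P i j))" using vi by simp
      also have "\<dots> = sum (v i) (\<Union>(P i ` J i))"
        using vi by (intro sum.UNION_disjoint[symmetric]) (auto simp: disjoint_family_on_def)
      also have "\<dots> \<le> sum (v i) (R \<union> \<Union>(B ` {..<n}))"
      proof (rule sum_mono2)
        show "\<Union>(P i ` J i) \<subseteq> R \<union> \<Union>(B ` {..<n})"
        proof
          fix x assume "x \<in> \<Union>(P i ` J i)"
          then have x: "x < m" using m i by blast
          show "x \<in> R \<union> \<Union>(B ` {..<n})"
          proof (cases "x < 2*n")
            case True
            then have "x < n \<or> (2*n-1-x < n \<and> x = 2*n-1-(2*n-1-x))" by auto
            then show ?thesis unfolding B_def by blast
          qed (use x in \<open>auto simp: R_def\<close>)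
        qed
      qed (use vi in \<open>auto simp: R_def B_def\<close>)
      also have "\<dots> = sum (v i) R + sum (v i) (\<Union>(B ` {..<n}))"
        by (intro sum.union_disjoint) (auto simp: R_def B_def)
      also have "sum (v i) (\<Union>(B ` {..<n})) = (\<Sum>k<n. sum (v i) (B k))"
        using disB by (intro sum.UNION_disjoint) (auto simp: disjoint_family_on_def B_def)
      finally show "(\<Sum>k<n. if 3/4 \<le> sum (v i) (B k) then sum (v i) (B k) else 3/4 + v i (2*n))
          \<le> sum (v i) R + (\<Sum>k<n. sum (v i) (B k))" by (simp add: sumB cong: if_cong)
    qed (use v Suc.prems(1) in \<open>auto simp: B_def R_def n_def\<close>)
    then obtain A where A: "disjoint_family_on A N" "\<And>i. i \<in> N \<Longrightarrow> finite (A i) \<and> 3/4 \<le> sum (v i) (A i)"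
      by blast
    have "3/4 \<le> sum (w i) (A i)" if "i \<in> N" for i
      using A(2)[OF that] v that sum_mono[of "A i" "v i" "w i"] by fastforce
    then show False using A contra by blast
  qed
qed

text \<open>When the owner of position \<open>j\<close> picks her favourite remaining good, only \<open>j\<close> goods are
  gone, so she gets at least her \<open>j\<close>-th best value (counting from 0).\<close>

lemma picking_sequence:
  fixes v :: "'i \<Rightarrow> 'a \<Rightarrow> real"
  assumes "finite M" "c \<le> card M"
    and g: "\<And>j. j < c \<Longrightarrow> bij_betw (g (own j)) {..<card M} M"
    and desc: "\<And>k l j. j < c \<Longrightarrow> k \<le> l \<Longrightarrow> l < card M \<Longrightarrow> v (own j) (g (own j) l) \<le> v (own j) (g (own j) k)"
  shows "\<exists>h. inj_on h {..<c} \<and> h ` {..<c} \<subseteq> M \<and> (\<forall>j<c. v (own j) (g (own j) j) \<le> v (own j) (h j))"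
  using assms
proof (induction c)
  case 0
  then show ?case by auto
next
  case (Suc c)
  then obtain h where h: "inj_on h {..<c}" "h ` {..<c} \<subseteq> M" "\<forall>j<c. v (own j) (g (own j) j) \<le> v (own j) (h j)"
    by (auto simp: less_Suc_eq)
  define i where "i = own c"
  have gi: "bij_betw (g i) {..<card M} M" using Suc.prems(3)[of c] by (simp add: i_def)
  have "\<exists>k\<le>c. g i k \<notin> h ` {..<c}"
  proof (rule ccontr)
    assume "\<not> ?thesis"
    then have "g i ` {..c} \<subseteq> h ` {..<c}" by auto
    moreover have "inj_on (g i) {..c}"
      using gi Suc.prems(2) by (auto simp: bij_betw_def intro: inj_on_subset)
    ultimately have "card {..c} \<le> card (h ` {..<c})" by (intro card_inj_on_le) auto
    then show False using card_image_le[of "{..<c}" h] by simp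
  qed
  then obtain k where k: "k \<le> c" "g i k \<notin> h ` {..<c}" by blast
  have kM: "g i k \<in> M" using gi k Suc.prems(2) by (auto simp: bij_betw_def)
  have le: "v i (g i c) \<le> v i (g i k)" using Suc.prems(4)[of c k c] k Suc.prems(2) by (simp add: i_def)
  have eq: "{..<Suc c} = insert c {..<c}" by auto
  show ?case
  proof (intro exI[of _ "h(c := g i k)"] conjI)
    show "inj_on (h(c := g i k)) {..<Suc c}"
      unfolding eq using h(1) k(2) by (simp add: inj_on_fun_updI)
    show "h(c := g i k) ` {..<Suc c} \<subseteq> M" unfolding eq using h(2) kM by auto
    show "\<forall>j<Suc c. v (own j) (g (own j) j) \<le> v (own j) ((h(c := g i k)) j)"
      using h(3) le by (auto simp: less_Suc_eq i_def)
  qed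
qed

text \<open>Sorting each agent's values separately gives an instance on positions in which all
  agents agree on the order. An allocation of positions turns back into one of goods when the owners
  pick in the order of positions, at no loss to anyone.\<close>

theorem three_quarters_mms:
  fixes v :: "'i \<Rightarrow> 'a \<Rightarrow> real"
  assumes "finite N" "finite M" "\<And>i x. i \<in> N \<Longrightarrow> x \<in> M \<Longrightarrow> 0 \<le> v i x"
    "\<And>i. i \<in> N \<Longrightarrow> has_packing (v i) (card N) M"
  shows "\<exists>A. disjoint_family_on A N \<and> (\<forall>i\<in>N. A i \<subseteq> M \<and> 3/4 \<le> sum (v i) (A i))"
proof -
  let ?m = "card M"
  have "\<forall>i\<in>N. \<exists>g w. bij_betw g {..<?m} M \<and> antimono w \<and> (\<forall>j. 0 \<le> w j) \<and>
    (\<forall>j<?m. w j = v i (g j)) \<and> (\<forall>j\<ge>?m. w j = 0)"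
    using sorted_values[OF assms(2)] assms(3) by blast
  then obtain g w where gw: "\<forall>i\<in>N. bij_betw (g i) {..<?m} M \<and> antimono (w i) \<and> (\<forall>j. 0 \<le> w i j) \<and>
    (\<forall>j<?m. w i j = v i (g i j)) \<and> (\<forall>j\<ge>?m. w i j = 0)" by metis
  have "\<exists>A. disjoint_family_on A N \<and> (\<forall>i\<in>N. finite (A i) \<and> 3/4 \<le> sum (w i) (A i))"
  proof (rule ordered_three_quarters_mms)
    fix i assume i: "i \<in> N"
    note gi = gw[rule_format, OF i]
    obtain P :: "nat \<Rightarrow> 'a set" and J where P: "finite J" "card J = card N" "disjoint_family_on P J"
      "\<And>j. j \<in> J \<Longrightarrow> P j \<subseteq> M" "\<And>j. j \<in> J \<Longrightarrow> 1 \<le> sum (v i) (P j)"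
      using has_packingE[OF assms(4)[OF i]] by metis
    show "has_packing (w i) (card N) UNIV"
    proof (rule has_packingI[of J _ "\<lambda>j. {x. x < ?m \<and> g i x \<in> P j}"])
      show "disjoint_family_on (\<lambda>j. {x. x < ?m \<and> g i x \<in> P j}) J"
        using P(3) by (auto simp: disjoint_family_on_def)
      fix j assume j: "j \<in> J"
      have "P j = g i ` {x. x < ?m \<and> g i x \<in> P j}"
        using gi P(4)[OF j] by (fastforce simp: bij_betw_def)
      then have "sum (v i) (P j) = sum (v i) (g i ` {x. x < ?m \<and> g i x \<in> P j})" by simp
      also have "\<dots> = sum (v i \<circ> g i) {x. x < ?m \<and> g i x \<in> P j}"
        using gi by (intro sum.reindex) (auto simp: bij_betw_def intro: inj_on_subset)
      also have "\<dots> = sum (w i) {x. x < ?m \<and> g i x \<in> P j}" using gi by (intro sum.cong) auto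
      finally show "finite {x. x < ?m \<and> g i x \<in> P j} \<and> {x. x < ?m \<and> g i x \<in> P j} \<subseteq> UNIV \<and>
        1 \<le> sum (w i) {x. x < ?m \<and> g i x \<in> P j}" using P(5)[OF j] by simp
    qed (use P in auto)
  qed (use gw assms(1) in auto)
  then obtain A where A: "disjoint_family_on A N" "\<And>i. i \<in> N \<Longrightarrow> finite (A i) \<and> 3/4 \<le> sum (w i) (A i)"
    by blast
  show ?thesis
  proof (cases "N = {}")
    case False
    then obtain i0 where i0: "i0 \<in> N" by blast
    \<comment> \<open>Unowned positions also need a picker; they go to \<open>i0\<close>, and these
      extra picks are thrown away at the end.\<close>
    define own where "own = (\<lambda>j. if \<exists>i\<in>N. j \<in> A i then (SOME i. i \<in> N \<and> j \<in> A i) else i0)"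
    have ownN: "own j \<in> N" for j
    proof (cases "\<exists>i\<in>N. j \<in> A i")
      case True
      then have "\<exists>i. i \<in> N \<and> j \<in> A i" by blast
      from someI_ex[OF this] True show ?thesis by (auto simp: own_def)
    qed (use i0 in \<open>simp add: own_def\<close>)
    have own: "own j = i" if "i \<in> N" "j \<in> A i" for i j
    proof -
      have "\<exists>i. i \<in> N \<and> j \<in> A i" using that by blast
      from someI_ex[OF this] have "own j \<in> N \<and> j \<in> A (own j)" using that by (auto simp: own_def)
      then show ?thesis using disjoint_family_on_eq_index[OF A(1)] that by blast
    qed
    have "\<exists>h. inj_on h {..<?m} \<and> h ` {..<?m} \<subseteq> M \<and> (\<forall>j<?m. v (own j) (g (own j) j) \<le> v (own j) (h j))"
    proof (rule picking_sequence[OF assms(2)])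
      fix k l j assume kl: "k \<le> l" "l < ?m"
      note o = gw[rule_format, OF ownN[of j]]
      have "w (own j) l \<le> w (own j) k" using o kl by (auto dest: antimonoD)
      moreover have "w (own j) l = v (own j) (g (own j) l)" "w (own j) k = v (own j) (g (own j) k)"
        using o kl by auto
      ultimately show "v (own j) (g (own j) l) \<le> v (own j) (g (own j) k)" by simp
    qed (use gw ownN in auto)
    then obtain h where h: "inj_on h {..<?m}" "h ` {..<?m} \<subseteq> M"
      "\<And>j. j < ?m \<Longrightarrow> v (own j) (g (own j) j) \<le> v (own j) (h j)" by blast
    show ?thesis
    proof (intro exI[of _ "\<lambda>i. h ` (A i \<inter> {..<?m})"] conjI ballI)
      show "disjoint_family_on (\<lambda>i. h ` (A i \<inter> {..<?m})) N"
        using A(1) h(1) unfolding disjoint_family_on_def inj_on_def by blast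
      fix i assume i: "i \<in> N"
      show "h ` (A i \<inter> {..<?m}) \<subseteq> M" using h(2) by auto
      have "sum (w i) (A i) = sum (w i) (A i \<inter> {..<?m})"
        using A(2)[OF i] gw i by (intro sum.mono_neutral_right) (auto simp flip: not_le)
      also have "\<dots> \<le> sum (v i \<circ> h) (A i \<inter> {..<?m})"
        using h(3) own[OF i] gw i by (intro sum_mono) (metis IntE comp_apply lessThan_iff)
      also have "\<dots> = sum (v i) (h ` (A i \<inter> {..<?m}))"
        using h(1) by (intro sum.reindex[symmetric]) (auto intro: inj_on_subset)
      finally show "3/4 \<le> sum (v i) (h ` (A i \<inter> {..<?m}))" using A(2)[OF i] by simp
    qed
  qed (auto simp: disjoint_family_on_def)
qed

section \<open>Transversals and clusters\<close>

text \<open>Hall's theorem by the Halmos-Vaughan induction. If a nonempty proper \<open>J\<close> is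
  tight, \<open>J\<close> is matched first and the rest avoids its neighbours, Hall's condition for
  \<open>L\<close> following from that for \<open>L \<union> J\<close>. Otherwise there is slack
  everywhere and one index may take any neighbour.\<close>

lemma marriage:
  fixes A :: "'i \<Rightarrow> 'a set"
  assumes "finite I" "\<forall>i\<in>I. finite (A i)" "\<forall>J\<subseteq>I. card J \<le> card (\<Union>(A ` J))"
  shows "\<exists>R. inj_on R I \<and> (\<forall>i\<in>I. R i \<in> A i)"
  using assms
proof (induction "card I" arbitrary: I A rule: less_induct)
  case less
  have finU: "finite (\<Union>(A ` J))" if "J \<subseteq> I" for J
    using less.prems(1,2) that finite_subset by blast
  show ?case
  proof (cases "\<exists>J. J \<subset> I \<and> J \<noteq> {} \<and> card (\<Union>(A ` J)) = card J")
    case True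
    then obtain J where J: "J \<subset> I" "J \<noteq> {}" "card (\<Union>(A ` J)) = card J" by blast
    have finJ: "finite J" using J(1) less.prems(1) by (meson finite_subset psubset_imp_subset)
    have "\<exists>R. inj_on R J \<and> (\<forall>i\<in>J. R i \<in> A i)"
      using less.hyps[OF psubset_card_mono[OF less.prems(1) J(1)] finJ, of A] less.prems(2,3) J(1)
      by (meson order_trans psubset_imp_subset subsetD)
    then obtain R1 where R1: "inj_on R1 J" "\<forall>i\<in>J. R1 i \<in> A i" by blast
    define A' where "A' = (\<lambda>i. A i - \<Union>(A ` J))"
    have "\<exists>R. inj_on R (I - J) \<and> (\<forall>i\<in>I - J. R i \<in> A' i)"
    proof (rule less.hyps)
      have "I - J \<subset> I" using J by auto
      then show "card (I - J) < card I" using less.prems(1) by (intro psubset_card_mono)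
      show "\<forall>L\<subseteq>I - J. card L \<le> card (\<Union>(A' ` L))"
      proof (intro allI impI)
        fix L assume L: "L \<subseteq> I - J"
        have "card L + card J = card (L \<union> J)"
          using L finJ less.prems(1) by (intro card_Un_disjoint[symmetric]) (auto intro: finite_subset)
        also have "\<dots> \<le> card (\<Union>(A ` (L \<union> J)))"
          using less.prems(3)[rule_format, of "L \<union> J"] L J(1) by blast
        also have "\<Union>(A ` (L \<union> J)) = \<Union>(A' ` L) \<union> \<Union>(A ` J)" by (auto simp: A'_def)
        also have "card \<dots> \<le> card (\<Union>(A' ` L)) + card (\<Union>(A ` J))" by (rule card_Un_le)
        finally show "card L \<le> card (\<Union>(A' ` L))" using J(3) by simp
      qed
    qed (use less.prems in \<open>auto simp: A'_def\<close>)
    then obtain R2 where R2: "inj_on R2 (I - J)" "\<forall>i\<in>I - J. R2 i \<in> A' i" by blast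
    have cross: "R1 i \<noteq> R2 l" if "i \<in> J" "l \<in> I - J" for i l
    proof -
      have "R1 i \<in> \<Union>(A ` J)" using R1(2) that(1) by blast
      moreover have "R2 l \<notin> \<Union>(A ` J)" using R2(2) that(2) unfolding A'_def by blast
      ultimately show ?thesis by metis
    qed
    show ?thesis
    proof (intro exI[of _ "\<lambda>i. if i \<in> J then R1 i else R2 i"] conjI ballI)
      show "inj_on (\<lambda>i. if i \<in> J then R1 i else R2 i) I"
      proof (rule inj_onI)
        fix i l assume "i \<in> I" "l \<in> I" "(if i \<in> J then R1 i else R2 i) = (if l \<in> J then R1 l else R2 l)"
        then show "i = l"
          using cross[of i l] cross[of l i] inj_onD[OF R1(1), of i l] inj_onD[OF R2(1), of i l]
          by (auto split: if_splits)
      qed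
      show "(if i \<in> J then R1 i else R2 i) \<in> A i" if "i \<in> I" for i
        using that R1(2) R2(2) by (auto simp: A'_def)
    qed
  next
    case False
    show ?thesis
    proof (cases "I = {}")
      case nonempty: False
      then obtain i where i: "i \<in> I" by blast
      have "card {i} \<le> card (\<Union>(A ` {i}))" using less.prems(3) i by blast
      then have "A i \<noteq> {}" by auto
      then obtain x where x: "x \<in> A i" by blast
      have "\<exists>R. inj_on R (I - {i}) \<and> (\<forall>l\<in>I - {i}. R l \<in> A l - {x})"
      proof (rule less.hyps)
        show "card (I - {i}) < card I" using i less.prems(1) by (intro psubset_card_mono) auto
        show "\<forall>L\<subseteq>I - {i}. card L \<le> card (\<Union>l\<in>L. A l - {x})"
        proof (intro allI impI)
          fix L assume L: "L \<subseteq> I - {i}"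
          show "card L \<le> card (\<Union>l\<in>L. A l - {x})"
          proof (cases "L = {}")
            case ne: False
            have "L \<subset> I" using L i by auto
            then have "card L \<noteq> card (\<Union>(A ` L))" using False ne by metis
            moreover have "card L \<le> card (\<Union>(A ` L))" using less.prems(3) \<open>L \<subset> I\<close> by auto
            moreover have "(\<Union>l\<in>L. A l - {x}) = \<Union>(A ` L) - {x}" by auto
            moreover have "card (\<Union>(A ` L)) - 1 \<le> card (\<Union>(A ` L) - {x})"
              using finU[of L] \<open>L \<subset> I\<close> by (simp add: card_Diff_singleton_if)
            ultimately show ?thesis by simp
          qed simp
        qed
      qed (use less.prems in auto)
      then obtain R where R: "inj_on R (I - {i})" "\<forall>l\<in>I - {i}. R l \<in> A l - {x}" by blast
      have "inj_on (R(i := x)) (insert i (I - {i}))"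
      proof (subst inj_on_insert, intro conjI)
        show "inj_on (R(i := x)) (I - {i})" using R(1) by (auto simp: inj_on_def)
        show "(R(i := x)) i \<notin> (R(i := x)) ` (I - {i} - {i})" using R(2) by auto
      qed
      then have "inj_on (R(i := x)) I" using i by (simp add: insert_absorb)
      moreover have "\<forall>l\<in>I. (R(i := x)) l \<in> A l" using R(2) x by auto
      ultimately show ?thesis by blast
    qed auto
  qed
qed

lemma top_subset:
  fixes f :: "'a \<Rightarrow> real"
  assumes "finite C" "t \<le> card C"
  shows "\<exists>B\<subseteq>C. card B = t \<and> (\<forall>x\<in>B. \<forall>y\<in>C - B. f y \<le> f x)"
proof -
  obtain g where g: "bij_betw g {..<card C} C" "\<forall>i j. i \<le> j \<longrightarrow> j < card C \<longrightarrow> f (g j) \<le> f (g i)"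
    using sorted_enumeration[OF assms(1)] by blast
  show ?thesis
  proof (intro exI[of _ "g ` {..<t}"] conjI ballI)
    show "g ` {..<t} \<subseteq> C" using g(1) assms(2) by (auto simp: bij_betw_def)
    have "inj_on g {..<t}" using g(1) assms(2) by (auto simp: bij_betw_def intro: inj_on_subset)
    then show "card (g ` {..<t}) = t" by (simp add: card_image)
    fix x y assume xy: "x \<in> g ` {..<t}" "y \<in> C - g ` {..<t}"
    obtain i where "i < t" "x = g i" using xy(1) by auto
    moreover obtain j where "j < card C" "y = g j" using xy(2) g(1) by (auto simp: bij_betw_def)
    moreover from this have "t \<le> j" using xy(2) by (metis DiffD2 image_eqI lessThan_iff not_le)
    ultimately show "f y \<le> f x" using g(2) by simp
  qed
qed

text \<open>The blocks consist of consecutive elements in descending order of value: any element of a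
  block is worth at least as much as all elements of the next one.\<close>

lemma block_family:
  fixes f :: "'a \<Rightarrow> real"
  assumes "finite C" "t \<ge> 1" "\<forall>x\<in>C. 0 \<le> f x \<and> f x \<le> a" "0 \<le> a"
  shows "\<exists>\<B>. disjoint \<B> \<and> (\<forall>B\<in>\<B>. B \<subseteq> C \<and> card B = t) \<and>
    (\<forall>D\<subseteq>C. (\<forall>B\<in>\<B>. D \<inter> B \<noteq> {}) \<longrightarrow> sum f C \<le> (real t - 1) * a + real t * sum f D)"
  using assms
proof (induction "card C" arbitrary: C a rule: less_induct)
  case less
  show ?case
  proof (cases "card C < t")
    case True
    have bound: "sum f C \<le> (real t - 1) * a"
    proof -
      have "sum f C \<le> of_nat (card C) * a" using less.prems by (intro sum_bounded_above) auto
      also have "\<dots> \<le> (real t - 1) * a" using True less.prems by (intro mult_right_mono) auto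
      finally show ?thesis .
    qed
    have "sum f C \<le> (real t - 1) * a + real t * sum f D" if "D \<subseteq> C" for D
      using bound sum_nonneg[of D f] less.prems(3) that by (simp add: add_increasing2 subset_iff)
    then show ?thesis by (intro exI[of _ "{}"]) auto
  next
    case False
    then obtain B where B: "B \<subseteq> C" "card B = t" "\<forall>x\<in>B. \<forall>y\<in>C - B. f y \<le> f x"
      using top_subset[OF less.prems(1), of t f] by force
    have finB: "finite B" using B(1) less.prems(1) finite_subset by blast
    have neB: "B \<noteq> {}" using B(2) less.prems(2) by auto
    \<comment> \<open>The worst value \<open>m\<close> of the top block bounds all remaining
      elements and replaces \<open>a\<close> in the induction hypothesis. The loss
      \<open>(t - 1) * m\<close> there and one more \<open>m\<close> in \<open>B\<close> are paid by
      \<open>t\<close> times an element of \<open>D\<close> in \<open>B\<close>.\<close>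
    define m where "m = Min (f ` B)"
    have "m \<in> f ` B" unfolding m_def using finB neB by (intro Min_in) auto
    then obtain b where b: "b \<in> B" "f b = m" by auto
    have mle: "m \<le> f x" if "x \<in> B" for x unfolding m_def using finB that by simp
    have m0: "0 \<le> m" using b B(1) less.prems(3) by auto
    have "\<exists>\<B>. disjoint \<B> \<and> (\<forall>B'\<in>\<B>. B' \<subseteq> C - B \<and> card B' = t) \<and>
      (\<forall>D\<subseteq>C - B. (\<forall>B'\<in>\<B>. D \<inter> B' \<noteq> {}) \<longrightarrow> sum f (C - B) \<le> (real t - 1) * m + real t * sum f D)"
    proof (rule less.hyps)
      show "card (C - B) < card C" using B(1) neB less.prems(1) by (intro psubset_card_mono) auto
      show "\<forall>x\<in>C - B. 0 \<le> f x \<and> f x \<le> m" using less.prems(3) B(3) b by auto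
    qed (use less.prems m0 in auto)
    then obtain \<B> where \<B>: "disjoint \<B>" "\<forall>B'\<in>\<B>. B' \<subseteq> C - B \<and> card B' = t"
      "\<forall>D\<subseteq>C - B. (\<forall>B'\<in>\<B>. D \<inter> B' \<noteq> {}) \<longrightarrow> sum f (C - B) \<le> (real t - 1) * m + real t * sum f D"
      by blast
    show ?thesis
    proof (intro exI[of _ "insert B \<B>"] conjI allI impI)
      show "disjoint (insert B \<B>)"
        using \<B>(1,2) unfolding disjoint_def by blast
      show "\<forall>B'\<in>insert B \<B>. B' \<subseteq> C \<and> card B' = t" using \<B>(2) B by auto
      fix D assume D: "D \<subseteq> C" "\<forall>B'\<in>insert B \<B>. D \<inter> B' \<noteq> {}"
      have finD: "finite D" using D(1) less.prems(1) finite_subset by blast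
      have "(D - B) \<inter> B' \<noteq> {}" if "B' \<in> \<B>" for B'
      proof -
        have "D \<inter> B' \<noteq> {}" "B' \<inter> B = {}" using D(2) \<B>(2) that by auto
        then show ?thesis by auto
      qed
      then have 1: "sum f (C - B) \<le> (real t - 1) * m + real t * sum f (D - B)" 
        using \<B>(3)[rule_format, of "D - B"] D(1) by auto
      obtain d where d: "d \<in> D \<inter> B" using D(2) by auto
      have "m \<le> f d" using d mle by auto
      also have "f d \<le> sum f (D \<inter> B)"
        using d finD D(1) less.prems(3) by (intro member_le_sum) auto
      finally have "real t * m \<le> real t * sum f (D \<inter> B)" by (intro mult_left_mono) auto
      moreover have "sum f D = sum f (D \<inter> B) + sum f (D - B)" using finD by (rule sum.Int_Diff)
      moreover have "sum f C = sum f (C - B) + sum f B" using B(1) less.prems(1) by (rule sum.subset_diff)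
      moreover have "sum f B \<le> m + (real t - 1) * a"
      proof -
        have "sum f B = f b + sum f (B - {b})" using finB b(1) by (rule sum.remove)
        also have "sum f (B - {b}) \<le> of_nat (card (B - {b})) * a"
          using B(1) less.prems(3) by (intro sum_bounded_above) auto
        finally show ?thesis using b B(2) finB less.prems(2) by (simp add: of_nat_diff)
      qed
      ultimately show "sum f C \<le> (real t - 1) * a + real t * sum f D"
        using 1 by (simp add: algebra_simps)
    qed
  qed
qed

text \<open>Hall's condition by double counting: \<open>card J\<close> blocks have
  \<open>card J * t\<close> incidences with elements, while an element lies in at most one block of
  each \<open>c\<close>, hence in at most \<open>t\<close> blocks.\<close>

lemma disjoint_transversals:
  fixes \<B> :: "'c \<Rightarrow> 'a set set"
  assumes fin: "finite Cs" and card: "card Cs \<le> t" "t \<ge> 1"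
    and \<B>: "\<And>c. c \<in> Cs \<Longrightarrow> disjoint (\<B> c)" "\<And>c. c \<in> Cs \<Longrightarrow> finite (\<B> c)"
      "\<And>c B. c \<in> Cs \<Longrightarrow> B \<in> \<B> c \<Longrightarrow> card B = t"
  shows "\<exists>D. disjoint_family_on D Cs \<and> (\<forall>c\<in>Cs. \<forall>B\<in>\<B> c. D c \<inter> B \<noteq> {})"
proof -
  have finB: "finite B" if "c \<in> Cs" "B \<in> \<B> c" for c B
    using \<B>(3)[OF that] card(2) by (metis card.infinite not_one_le_zero)
  have "\<exists>R. inj_on R (Sigma Cs \<B>) \<and> (\<forall>p\<in>Sigma Cs \<B>. R p \<in> snd p)"
  proof (rule marriage)
    show "finite (Sigma Cs \<B>)" using fin \<B>(2) by blast
    show "\<forall>p\<in>Sigma Cs \<B>. finite (snd p)" using finB by auto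
    show "\<forall>J\<subseteq>Sigma Cs \<B>. card J \<le> card (\<Union>(snd ` J))"
    proof (intro allI impI)
      fix J assume J: "J \<subseteq> Sigma Cs \<B>"
      have finJ: "finite J" using J fin \<B>(2) by (meson finite_SigmaI finite_subset)
      have fins: "\<forall>p\<in>J. finite (snd p)" using J finB by auto
      let ?U = "\<Union>(snd ` J)"
      have finU: "finite ?U" using finJ fins by blast
      have "inj_on (\<lambda>(p, x). (fst p, x)) (Sigma J snd)"
      proof (rule inj_onI, clarsimp)
        fix c B B' x assume "(c, B) \<in> J" "x \<in> B" "(c, B') \<in> J" "x \<in> B'"
        moreover from this have "c \<in> Cs" "B \<in> \<B> c" "B' \<in> \<B> c" using J by auto
        ultimately show "B = B'" using \<B>(1)[of c] unfolding disjoint_def by blast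
      qed
      moreover have "(\<lambda>(p, x). (fst p, x)) ` Sigma J snd \<subseteq> Cs \<times> ?U" using J by force
      ultimately have "card (Sigma J snd) \<le> card (Cs \<times> ?U)"
        using fin finU by (intro card_inj_on_le) auto
      moreover have "card (Sigma J snd) = card J * t"
      proof -
        have "card (Sigma J snd) = (\<Sum>p\<in>J. card (snd p))" using finJ fins by simp
        also have "\<dots> = (\<Sum>p\<in>J. t)" using J \<B>(3) by (intro sum.cong) auto
        finally show ?thesis by simp
      qed
      ultimately have "card J * t \<le> card Cs * card ?U" by (simp add: card_cartesian_product)
      also have "\<dots> \<le> card ?U * t" using card(1) by (simp add: mult.commute)
      finally show "card J \<le> card ?U" using card(2) by simp
    qed
  qed
  then obtain R where R: "inj_on R (Sigma Cs \<B>)" "\<forall>p\<in>Sigma Cs \<B>. R p \<in> snd p" by blast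
  show ?thesis
  proof (intro exI[of _ "\<lambda>c. (\<lambda>B. R (c, B)) ` \<B> c"] conjI ballI)
    show "disjoint_family_on (\<lambda>c. (\<lambda>B. R (c, B)) ` \<B> c) Cs"
      unfolding disjoint_family_on_def
    proof (intro ballI impI)
      fix c d assume cd: "c \<in> Cs" "d \<in> Cs" "c \<noteq> d"
      have "R (c, B) \<noteq> R (d, B')" if "B \<in> \<B> c" "B' \<in> \<B> d" for B B'
        using inj_onD[OF R(1), of "(c, B)" "(d, B')"] cd that by auto
      then show "(\<lambda>B. R (c, B)) ` \<B> c \<inter> (\<lambda>B. R (d, B)) ` \<B> d = {}" by blast
    qed
    show "(\<lambda>B. R (c, B)) ` \<B> c \<inter> B \<noteq> {}" if "c \<in> Cs" "B \<in> \<B> c" for c B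
      using R(2) that by fastforce
  qed
qed

text \<open>The sets \<open>K\<close> and \<open>I\<close> play the roles of the clique and the independent set, and \<open>E x v\<close>
  says that \<open>x \<in> I\<close> is adjacent to \<open>v \<in> K\<close>. Every \<open>x\<close> in the transversal of a type is attached to a
  neighbour from that type's own bundle; this gives clusters around the vertices of \<open>K\<close> that
  can be combined freely, and each type still has \<open>card N\<close> groups of clusters worth \<open>4a/3\<close>.\<close>

lemma small_goods_allocation:
  fixes u :: "'i \<Rightarrow> 'a \<Rightarrow> real" and E :: "'a \<Rightarrow> 'a \<Rightarrow> bool" and a :: real
  assumes fin: "finite N" "finite K" "finite I" and KI: "K \<inter> I = {}"
    and u0: "\<And>i x. i \<in> N \<Longrightarrow> x \<in> K \<union> I \<Longrightarrow> 0 \<le> u i x"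
    and small: "\<And>i x. i \<in> N \<Longrightarrow> x \<in> I \<Longrightarrow> u i x \<le> a"
    and a: "0 < a" "a * (7 * real t - 3) \<le> 3" and t: "t \<ge> 1" "card (u ` N) \<le> t"
    and pack: "\<And>i. i \<in> N \<Longrightarrow> \<exists>P J. finite (J :: nat set) \<and> card J = card N \<and> disjoint_family_on P J \<and>
      (\<forall>j\<in>J. P j \<subseteq> K \<union> I \<and> (\<forall>x\<in>P j \<inter> I. \<exists>v\<in>P j \<inter> K. E x v) \<and> 1 \<le> sum (u i) (P j))"
  shows "\<exists>A. disjoint_family_on A N \<and> (\<forall>i\<in>N. A i \<subseteq> K \<union> I \<and> A i \<inter> K \<noteq> {} \<and>
    (\<forall>x\<in>A i \<inter> I. \<exists>v\<in>A i \<inter> K. E x v) \<and> a \<le> sum (u i) (A i))"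
proof -
  \<comment> \<open>Bundles and transversals are chosen per utility function: agents of one type
    share them, so at most \<open>t\<close> transversals have to be disjoint.\<close>
  define Ts where "Ts = u ` N"
  have "\<forall>c\<in>Ts. \<exists>P J. finite (J :: nat set) \<and> card J = card N \<and> disjoint_family_on P J \<and>
      (\<forall>j\<in>J. P j \<subseteq> K \<union> I \<and> (\<forall>x\<in>P j \<inter> I. \<exists>v\<in>P j \<inter> K. E x v) \<and> 1 \<le> sum c (P j))"
    unfolding Ts_def using pack by blast
  then obtain P J where PJ: "\<forall>c\<in>Ts. finite (J c :: nat set) \<and> card (J c) = card N \<and> disjoint_family_on (P c) (J c) \<and>
      (\<forall>j\<in>J c. P c j \<subseteq> K \<union> I \<and> (\<forall>x\<in>P c j \<inter> I. \<exists>v\<in>P c j \<inter> K. E x v) \<and> 1 \<le> sum c (P c j))"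
    by metis
  have J: "finite (J c)" "card (J c) = card N" "disjoint_family_on (P c) (J c)" if "c \<in> Ts" for c
    using PJ that by auto
  have P: "P c j \<subseteq> K \<union> I" "1 \<le> sum c (P c j)" "\<And>x. x \<in> P c j \<inter> I \<Longrightarrow> \<exists>v\<in>P c j \<inter> K. E x v"
    if "c \<in> Ts" "j \<in> J c" for c j using PJ that by auto
  have finTs: "finite Ts" using fin by (simp add: Ts_def)
  have c0: "0 \<le> c x" if "c \<in> Ts" "x \<in> K \<union> I" for c x using that u0 by (auto simp: Ts_def)
  have ca: "c x \<le> a" if "c \<in> Ts" "x \<in> I" for c x using that small by (auto simp: Ts_def)
  have "\<forall>c\<in>Ts. \<forall>j\<in>J c. \<exists>\<B>. disjoint \<B> \<and> (\<forall>B\<in>\<B>. B \<subseteq> P c j \<inter> I \<and> card B = t) \<and>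
    (\<forall>D\<subseteq>P c j \<inter> I. (\<forall>B\<in>\<B>. D \<inter> B \<noteq> {}) \<longrightarrow> sum c (P c j \<inter> I) \<le> (real t - 1) * a + real t * sum c D)"
    using fin(3) t(1) c0 ca a(1) by (intro ballI block_family) auto
  then obtain \<B> where \<B>: "\<And>c j. c \<in> Ts \<Longrightarrow> j \<in> J c \<Longrightarrow> disjoint (\<B> c j)"
    "\<And>c j B. c \<in> Ts \<Longrightarrow> j \<in> J c \<Longrightarrow> B \<in> \<B> c j \<Longrightarrow> B \<subseteq> P c j \<inter> I \<and> card B = t"
    "\<And>c j D. c \<in> Ts \<Longrightarrow> j \<in> J c \<Longrightarrow> D \<subseteq> P c j \<inter> I \<Longrightarrow> \<forall>B\<in>\<B> c j. D \<inter> B \<noteq> {} \<Longrightarrow>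
      sum c (P c j \<inter> I) \<le> (real t - 1) * a + real t * sum c D"
    by metis
  have "\<exists>D. disjoint_family_on D Ts \<and> (\<forall>c\<in>Ts. \<forall>B\<in>\<Union>(\<B> c ` J c). D c \<inter> B \<noteq> {})"
  proof (rule disjoint_transversals[OF finTs t(2)[folded Ts_def] t(1)])
    fix c assume c: "c \<in> Ts"
    have "\<Union>(\<B> c ` J c) \<subseteq> Pow I" using \<B>(2)[OF c] by blast
    then show "finite (\<Union>(\<B> c ` J c))" using fin(3) by (meson finite_Pow_iff finite_subset)
    show "card B = t" if "B \<in> \<Union>(\<B> c ` J c)" for B using that \<B>(2)[OF c] by blast
    show "disjoint (\<Union>(\<B> c ` J c))"
    proof (rule disjointI)
      fix B B' assume BB: "B \<in> \<Union>(\<B> c ` J c)" "B' \<in> \<Union>(\<B> c ` J c)" "B \<noteq> B'"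
      then obtain j j' where j: "j \<in> J c" "B \<in> \<B> c j" "j' \<in> J c" "B' \<in> \<B> c j'" by blast
      show "B \<inter> B' = {}"
      proof (cases "j = j'")
        case True
        then show ?thesis using \<B>(1)[OF c j(1)] j BB(3) by (auto dest: disjointD)
      next
        case False
        then have "P c j \<inter> P c j' = {}" using J(3)[OF c] j unfolding disjoint_family_on_def by blast
        then show ?thesis using \<B>(2)[OF c j(1,2)] \<B>(2)[OF c j(3,4)] by blast
      qed
    qed
  qed
  then obtain D where D: "disjoint_family_on D Ts" "\<forall>c\<in>Ts. \<forall>B\<in>\<Union>(\<B> c ` J c). D c \<inter> B \<noteq> {}"
    by blast
  have share: "sum c (P c j \<inter> I) \<le> (real t - 1) * a + real t * sum c (D c \<inter> P c j \<inter> I)"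
    if "c \<in> Ts" "j \<in> J c" for c j
  proof (rule \<B>(3)[OF that])
    show "\<forall>B\<in>\<B> c j. D c \<inter> P c j \<inter> I \<inter> B \<noteq> {}"
    proof
      fix B assume B: "B \<in> \<B> c j"
      then have "D c \<inter> B \<noteq> {}" using D(2) that by auto
      then show "D c \<inter> P c j \<inter> I \<inter> B \<noteq> {}" using \<B>(2)[OF that B] by auto
    qed
  qed auto
  define X where "X = {x \<in> I. \<exists>c\<in>Ts. \<exists>j\<in>J c. x \<in> D c \<inter> P c j}"
  \<comment> \<open>The existential quantifiers cause no ambiguity: the sets \<open>D c\<close> are
    disjoint, and so are the bundles of one type, so \<open>x\<close> determines \<open>c\<close>
    and \<open>j\<close>.\<close>
  define f where "f = (\<lambda>x. SOME v. \<exists>c\<in>Ts. \<exists>j\<in>J c. x \<in> D c \<inter> P c j \<and> v \<in> P c j \<inter> K \<and> E x v)"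
  have f: "f x \<in> P c j \<inter> K \<and> E x (f x)" if h: "c \<in> Ts" "j \<in> J c" "x \<in> D c \<inter> P c j \<inter> I" for c j x
  proof -
    obtain v where "v \<in> P c j \<inter> K" "E x v" using P(3)[OF h(1,2), of x] h(3) by blast
    then have "\<exists>v. \<exists>c\<in>Ts. \<exists>j\<in>J c. x \<in> D c \<inter> P c j \<and> v \<in> P c j \<inter> K \<and> E x v"
      using h by blast
    then have "\<exists>c\<in>Ts. \<exists>j\<in>J c. x \<in> D c \<inter> P c j \<and> f x \<in> P c j \<inter> K \<and> E x (f x)"
      unfolding f_def by (rule someI_ex)
    then obtain c' j' where
      c': "c' \<in> Ts" "j' \<in> J c'" "x \<in> D c' \<inter> P c' j'" "f x \<in> P c' j' \<inter> K" "E x (f x)" by blast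
    have "c' = c" using disjoint_family_on_eq_index[OF D(1), of c' c x] c' h by blast
    moreover from this have "j' = j" using disjoint_family_on_eq_index[OF J(3)[OF h(1)], of j' j x] c' h by blast
    ultimately show ?thesis using c' by blast
  qed
  have fX: "f x \<in> K \<and> E x (f x)" if "x \<in> X" for x using that f by (fastforce simp: X_def)
  define cl where "cl = (\<lambda>v. insert v {x \<in> X. f x = v})"
  have XI: "X \<subseteq> I" by (auto simp: X_def)
  have clKI: "cl v \<subseteq> K \<union> I" if "v \<in> K" for v using that XI by (auto simp: cl_def)
  have fincl: "finite (cl v)" for v using XI fin(3) by (auto simp: cl_def intro: finite_subset)
  have cldisj: "cl v \<inter> cl v' = {}" if "v \<in> K" "v' \<in> K" "v \<noteq> v'" for v v'
    using that XI KI by (auto simp: cl_def)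
  have sumcl: "(\<Sum>v\<in>S. sum c (cl v)) = sum c (\<Union>(cl ` S))" if "S \<subseteq> K" for S and c :: "'a \<Rightarrow> real"
  proof (rule sum.UNION_disjoint[symmetric])
    show "\<forall>v\<in>S. \<forall>v'\<in>S. v \<noteq> v' \<longrightarrow> cl v \<inter> cl v' = {}" using cldisj that by blast
  qed (use that fin(2) fincl in \<open>auto intro: finite_subset\<close>)
  \<comment> \<open>In units of \<open>4 * a / 3\<close> every type has bundles of clusters worth at
    least 1, and 3/4 of a unit is \<open>a\<close>.\<close>
  have "\<exists>A. disjoint_family_on A N \<and> (\<forall>i\<in>N. A i \<subseteq> K \<and> 3/4 \<le> sum (\<lambda>v. sum (u i) (cl v) / (4 * a / 3)) (A i))"
  proof (rule three_quarters_mms[OF fin(1,2)])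
    show "0 \<le> sum (u i) (cl v) / (4 * a / 3)" if "i \<in> N" "v \<in> K" for i v
      using clKI[OF that(2)] u0[OF that(1)] a(1) by (intro divide_nonneg_pos sum_nonneg) auto
    fix i assume i: "i \<in> N"
    define c where "c = u i"
    have c: "c \<in> Ts" using i by (simp add: c_def Ts_def)
    show "has_packing (\<lambda>v. sum (u i) (cl v) / (4 * a / 3)) (card N) K"
      unfolding c_def[symmetric]
    proof (rule has_packingI[OF J(1,2)[OF c]])
      show "disjoint_family_on (\<lambda>j. P c j \<inter> K) (J c)"
        using J(3)[OF c] unfolding disjoint_family_on_def by blast
      fix j assume j: "j \<in> J c"
      have finP: "finite (P c j)" using P(1)[OF c j] fin by (meson finite_UnI finite_subset)
      have "(P c j \<inter> K) \<union> (D c \<inter> P c j \<inter> I) \<subseteq> \<Union>(cl ` (P c j \<inter> K))"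
        using f[OF c j] c j by (auto simp: cl_def X_def)
      moreover have "\<Union>(cl ` (P c j \<inter> K)) \<subseteq> K \<union> I" using clKI by blast
      ultimately have "sum c ((P c j \<inter> K) \<union> (D c \<inter> P c j \<inter> I)) \<le> sum c (\<Union>(cl ` (P c j \<inter> K)))"
        using finP fincl c0[OF c] by (intro sum_mono2) auto
      also have "sum c ((P c j \<inter> K) \<union> (D c \<inter> P c j \<inter> I)) = sum c (P c j \<inter> K) + sum c (D c \<inter> P c j \<inter> I)"
        using finP KI by (intro sum.union_disjoint) auto
      finally have 1: "sum c (P c j \<inter> K) + sum c (D c \<inter> P c j \<inter> I) \<le> (\<Sum>v\<in>P c j \<inter> K. sum c (cl v))"
        using sumcl[of "P c j \<inter> K" c] by simp
      have "P c j = (P c j \<inter> K) \<union> (P c j \<inter> I)" using P(1)[OF c j] by blast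
      then have "sum c (P c j) = sum c (P c j \<inter> K) + sum c (P c j \<inter> I)"
        using sum.union_disjoint[of "P c j \<inter> K" "P c j \<inter> I" c] finP KI by auto
      then have 2: "1 \<le> sum c (P c j \<inter> K) + ((real t - 1) * a + real t * sum c (D c \<inter> P c j \<inter> I))"
        using P(2)[OF c j] share[OF c j] by simp
      have "0 \<le> sum c (P c j \<inter> K)" using c0[OF c] by (intro sum_nonneg) auto
      \<comment> \<open>The clique part is kept whole; enlarging it \<open>t\<close> times puts both
        parts under one factor.\<close>
      then have 3: "sum c (P c j \<inter> K) \<le> real t * sum c (P c j \<inter> K)" using t(1) by (simp add: mult_le_cancel_right1)
      have "1 - (real t - 1) * a \<le> real t * (\<Sum>v\<in>P c j \<inter> K. sum c (cl v))"
      proof -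
        have "real t * (sum c (P c j \<inter> K) + sum c (D c \<inter> P c j \<inter> I)) \<le> real t * (\<Sum>v\<in>P c j \<inter> K. sum c (cl v))"
          using 1 by (intro mult_left_mono) auto
        then show ?thesis using 2 3 by (simp add: distrib_left)
      qed
      \<comment> \<open>Multiplied by 3 this is the hypothesis
        \<open>a * (7 * real t - 3) \<le> 3\<close>, which is where the constant originates.\<close>
      moreover have "real t * (4 * a / 3) \<le> 1 - (real t - 1) * a" using a(2) by (simp add: algebra_simps)
      ultimately have "real t * (4 * a / 3) \<le> real t * (\<Sum>v\<in>P c j \<inter> K. sum c (cl v))" by linarith
      then have "4 * a / 3 \<le> (\<Sum>v\<in>P c j \<inter> K. sum c (cl v))" using t(1) by (subst (asm) mult_le_cancel_left_pos) auto
      then have "1 \<le> (\<Sum>v\<in>P c j \<inter> K. sum c (cl v)) / (4 * a / 3)" using a(1) by simp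
      then show "finite (P c j \<inter> K) \<and> P c j \<inter> K \<subseteq> K \<and> 1 \<le> (\<Sum>v\<in>P c j \<inter> K. sum c (cl v) / (4 * a / 3))"
        using finP unfolding sum_divide_distrib by blast
    qed
  qed
  then obtain A where A: "disjoint_family_on A N" "\<And>i. i \<in> N \<Longrightarrow> A i \<subseteq> K"
    "\<And>i. i \<in> N \<Longrightarrow> 3/4 \<le> sum (\<lambda>v. sum (u i) (cl v) / (4 * a / 3)) (A i)" by blast
  show ?thesis
  proof (intro exI[of _ "\<lambda>i. \<Union>(cl ` A i)"] conjI ballI)
    show "disjoint_family_on (\<lambda>i. \<Union>(cl ` A i)) N"
      unfolding disjoint_family_on_def
    proof (intro ballI impI)
      fix i l assume il: "i \<in> N" "l \<in> N" "i \<noteq> l"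
      then have "A i \<inter> A l = {}" using A(1) unfolding disjoint_family_on_def by blast
      then have "cl v \<inter> cl v' = {}" if "v \<in> A i" "v' \<in> A l" for v v'
        using cldisj[of v v'] A(2) il that by blast
      then show "\<Union>(cl ` A i) \<inter> \<Union>(cl ` A l) = {}" by blast
    qed
    fix i assume i: "i \<in> N"
    show "\<Union>(cl ` A i) \<subseteq> K \<union> I" using clKI A(2)[OF i] by blast
    have "3/4 \<le> (\<Sum>v\<in>A i. sum (u i) (cl v)) / (4 * a / 3)" using A(3)[OF i] unfolding sum_divide_distrib .
    then have "a \<le> (\<Sum>v\<in>A i. sum (u i) (cl v))" using a(1) by (simp add: field_simps)
    then show "a \<le> sum (u i) (\<Union>(cl ` A i))" using sumcl[OF A(2)[OF i]] by simp
    have "A i \<noteq> {}" using A(3)[OF i] by auto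
    then show "\<Union>(cl ` A i) \<inter> K \<noteq> {}" using A(2)[OF i] by (auto simp: cl_def)
    fix x assume x: "x \<in> \<Union>(cl ` A i) \<inter> I"
    then obtain v where "v \<in> A i" "x \<in> cl v" by blast
    moreover have "v \<in> K" using A(2)[OF i] \<open>v \<in> A i\<close> by blast
    ultimately have "x \<in> X" "f x = v" using x KI by (auto simp: cl_def)
    then have "E x v" using fX by blast
    then show "\<exists>v\<in>\<Union>(cl ` A i) \<inter> K. E x v" using \<open>v \<in> A i\<close> \<open>v \<in> K\<close> by (auto simp: cl_def)
  qed
qed

section \<open>Bundles in split graphs\<close>

context graph
begin

lemma dominates_induce_iff: "x \<rightarrow>\<^bsub>G \<restriction> X\<^esub> y \<longleftrightarrow> x \<in> X \<and> y \<in> X \<and> x \<rightarrow>\<^bsub>G\<^esub> y"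
  by (auto simp: arcs_ends_conv)

lemma dominates_sym: "x \<rightarrow>\<^bsub>G\<^esub> y \<Longrightarrow> y \<rightarrow>\<^bsub>G\<^esub> x"
  by (rule arcs_ends_symmetric[OF sym_arcs])

lemma symmetric_induce: "symmetric (G \<restriction> X)"
  unfolding symmetric_def by (rule symI) (simp add: dominates_induce_iff dominates_sym)

text \<open>\<open>connected\<close> refers to the symmetric closure, which adds no reachability
  here as arcs come in opposite pairs.\<close>

lemma connected_induce_iff:
  "connected (G \<restriction> X) \<longleftrightarrow> X \<noteq> {} \<and> (\<forall>u\<in>X. \<forall>v\<in>X. u \<rightarrow>\<^sup>*\<^bsub>G \<restriction> X\<^esub> v)"
proof -
  interpret H: wf_digraph "G \<restriction> X" by (rule wellformed_induce_subgraph)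
  have "verts (with_proj (mk_symmetric (G \<restriction> X))) = X" by (simp add: mk_symmetric_def)
  then show ?thesis
    unfolding connected_def strongly_connected_def
    using H.reachable_mk_symmetric_eq[OF symmetric_induce] by auto
qed

lemma connected_induceI:
  assumes "v \<in> X" "\<And>x. x \<in> X \<Longrightarrow> x \<rightarrow>\<^sup>*\<^bsub>G \<restriction> X\<^esub> v"
  shows "connected (G \<restriction> X)"
proof -
  interpret H: wf_digraph "G \<restriction> X" by (rule wellformed_induce_subgraph)
  show ?thesis
    unfolding connected_induce_iff
    using assms symmetric_reachable[OF symmetric_induce] H.reachable_trans by blast
qed

lemma connected_induce_neighbour:
  assumes "connected (G \<restriction> X)" "x \<in> X" "X \<noteq> {x}"
  shows "\<exists>y\<in>X. x \<rightarrow>\<^bsub>G\<^esub> y"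
proof -
  obtain z where z: "z \<in> X" "z \<noteq> x" using assms(2,3) by blast
  have "x \<rightarrow>\<^sup>*\<^bsub>G \<restriction> X\<^esub> z" using assms(1,2) z by (simp add: connected_induce_iff)
  then show ?thesis
    by (rule pre_digraph.converse_reachable_cases) (use z dominates_induce_iff in auto)
qed

lemma is_bundle_singleton: "v \<in> verts G \<Longrightarrow> is_bundle G {v}"
proof -
  assume v: "v \<in> verts G"
  interpret H: wf_digraph "G \<restriction> {v}" by (rule wellformed_induce_subgraph)
  have "connected (G \<restriction> {v})" by (rule connected_induceI) auto
  then show ?thesis using v by (simp add: is_bundle_def)
qed

lemma is_bundle_insert:
  assumes "is_bundle G X" "x \<in> X" "x \<rightarrow>\<^bsub>G\<^esub> y"
  shows "is_bundle G (insert y X)"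
proof -
  interpret H: wf_digraph "G \<restriction> insert y X" by (rule wellformed_induce_subgraph)
  have "connected (G \<restriction> insert y X)"
  proof (rule connected_induceI[of x])
    fix z assume z: "z \<in> insert y X"
    show "z \<rightarrow>\<^sup>*\<^bsub>G \<restriction> insert y X\<^esub> x"
    proof (cases "z = y")
      case True
      then show ?thesis
        using assms dominates_sym by (intro H.reachable_adjI) (auto simp: dominates_induce_iff)
    next
      case False
      have "connected (G \<restriction> X)" using assms by (auto simp: is_bundle_def)
      then have "z \<rightarrow>\<^sup>*\<^bsub>G \<restriction> X\<^esub> x" using False z assms(2) by (auto simp: connected_induce_iff)
      then show ?thesis by (rule reachable_induce_ss) auto
    qed
  qed (use assms in auto)
  then show ?thesis using assms adj_in_verts(2) by (auto simp: is_bundle_def)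
qed

lemma is_bundle_clique_attached:
  assumes "X \<subseteq> K \<union> I" "K \<union> I = verts G" "X \<inter> K \<noteq> {}"
    and clique: "\<And>x y. x \<in> K \<Longrightarrow> y \<in> K \<Longrightarrow> x \<noteq> y \<Longrightarrow> x \<rightarrow>\<^bsub>G\<^esub> y"
    and attached: "\<And>x. x \<in> X \<inter> I \<Longrightarrow> \<exists>v\<in>X \<inter> K. x \<rightarrow>\<^bsub>G\<^esub> v"
  shows "is_bundle G X"
proof -
  interpret H: wf_digraph "G \<restriction> X" by (rule wellformed_induce_subgraph)
  obtain v where v: "v \<in> X \<inter> K" using assms(3) by blast
  have K: "x \<rightarrow>\<^sup>*\<^bsub>G \<restriction> X\<^esub> v" if "x \<in> X \<inter> K" for x
  proof (cases "x = v")
    case False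
    then show ?thesis using v that clique by (intro H.reachable_adjI) (auto simp: dominates_induce_iff)
  qed (use v in auto)
  have "connected (G \<restriction> X)"
  proof (rule connected_induceI[of v])
    fix x assume x: "x \<in> X"
    show "x \<rightarrow>\<^sup>*\<^bsub>G \<restriction> X\<^esub> v"
    proof (cases "x \<in> K")
      case False
      then obtain y where y: "y \<in> X \<inter> K" "x \<rightarrow>\<^bsub>G\<^esub> y" using attached[of x] x assms(1) by blast
      then have "x \<rightarrow>\<^bsub>G \<restriction> X\<^esub> y" using x by (simp add: dominates_induce_iff)
      then show ?thesis using K[OF y(1)] by (rule H.adj_reachable_trans)
    qed (use K x in auto)
  qed (use v in auto)
  then show ?thesis using assms(1,2) by (auto simp: is_bundle_def)
qed

lemma connected_crossing_arc:
  assumes "connected G" "S \<subseteq> verts G" "S \<noteq> {}" "S \<noteq> verts G"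
  shows "\<exists>x\<in>S. \<exists>y\<in>verts G - S. x \<rightarrow>\<^bsub>G\<^esub> y"
proof (rule ccontr)
  assume no: "\<not> ?thesis"
  obtain x z where x: "x \<in> S" and z: "z \<in> verts G - S" using assms by blast
  have "strongly_connected G" using symmetric_connected_imp_strongly_connected[OF sym_arcs assms(1)] .
  then have "x \<rightarrow>\<^sup>* z" using x z assms(2) by (auto simp: strongly_connected_def)
  then have "z \<in> S"
  proof (induction rule: reachable_induct)
    case (step a b)
    then show ?case using no adj_in_verts(2) by blast
  qed (rule x)
  then show False using z by blast
qed

text \<open>While vertices are uncovered, connectivity gives an arc leaving the union of the
  bundles, and its head can join the bundle of its tail.\<close>

lemma bundles_extend_to_partition:
  assumes "connected G" "n \<ge> 1" "disjoint_family_on A {1..n}" "\<And>i. i \<in> {1..n} \<Longrightarrow> is_bundle G (A i)"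
  shows "\<exists>A'. graph_partition G n A' \<and> (\<forall>i\<in>{1..n}. A i \<subseteq> A' i)"
  using assms
proof (induction "card (verts G - \<Union>(A ` {1..n}))" arbitrary: A rule: less_induct)
  case less
  define S where "S = \<Union>(A ` {1..n})"
  have SV: "S \<subseteq> verts G" using less.prems(4) by (fastforce simp: S_def is_bundle_def)
  show ?case
  proof (cases "S = verts G")
    case True
    then have "graph_partition G n A"
      using less.prems by (auto simp: graph_partition_def S_def)
    then show ?thesis by blast
  next
    case False
    have "\<exists>i\<in>{1..n}. \<exists>y\<in>verts G - S. is_bundle G (insert y (A i))"
    proof (cases "S = {}")
      case True
      \<comment> \<open>No arc leaves an empty union, so a single vertex starts the first
        bundle.\<close>
      then have "A 1 = {}" using less.prems(2) by (auto simp: S_def)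
      moreover obtain y where y: "y \<in> verts G - S" using False SV by blast
      ultimately have "is_bundle G (insert y (A 1))" using is_bundle_singleton[of y] by simp
      then show ?thesis using y less.prems(2) by (intro bexI[of _ 1] bexI[of _ y]) auto
    next
      case ne: False
      then obtain x y where xy: "x \<in> S" "y \<in> verts G - S" "x \<rightarrow>\<^bsub>G\<^esub> y"
        using connected_crossing_arc[OF less.prems(1) SV] False by blast
      then obtain i where "i \<in> {1..n}" "x \<in> A i" by (auto simp: S_def)
      then show ?thesis using is_bundle_insert[OF less.prems(4)] xy by blast
    qed
    then obtain i y where i: "i \<in> {1..n}" and y: "y \<in> verts G - S" and b: "is_bundle G (insert y (A i))"
      by blast
    define B where "B = A(i := insert y (A i))"
    have UB: "\<Union>(B ` {1..n}) = insert y S" using i by (auto simp: B_def S_def split: if_splits)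
    have "\<exists>A'. graph_partition G n A' \<and> (\<forall>i\<in>{1..n}. B i \<subseteq> A' i)"
    proof (rule less.hyps)
      have "verts G - insert y S \<subset> verts G - S" using y by blast
      then show "card (verts G - \<Union>(B ` {1..n})) < card (verts G - \<Union>(A ` {1..n}))"
        unfolding UB S_def[symmetric] by (intro psubset_card_mono) auto
      show "disjoint_family_on B {1..n}"
        using less.prems(3) y unfolding disjoint_family_on_def B_def S_def by auto
    qed (use less.prems b in \<open>auto simp: B_def\<close>)
    moreover have "A l \<subseteq> B l" for l by (auto simp: B_def)
    ultimately show ?thesis by (meson order_trans)
  qed
qed

text \<open>Vertices given away are removed from \<open>W\<close> and not from \<open>G\<close>, so
  adjacency and \<open>is_bundle\<close> refer to one graph throughout the induction.\<close>

lemma split_packing_allocation: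
  fixes u :: "'i \<Rightarrow> 'a \<Rightarrow> real"
  assumes KI: "K \<union> I = verts G" "K \<inter> I = {}"
    and clique: "\<And>x y. x \<in> K \<Longrightarrow> y \<in> K \<Longrightarrow> x \<noteq> y \<Longrightarrow> x \<rightarrow>\<^bsub>G\<^esub> y"
    and indep: "\<And>x y. x \<in> I \<Longrightarrow> y \<in> I \<Longrightarrow> \<not> x \<rightarrow>\<^bsub>G\<^esub> y"
    and a: "0 < a" "a * (7 * real t - 3) \<le> 3" and t: "t \<ge> 1"
    and "finite N" "W \<subseteq> verts G" "\<And>i x. i \<in> N \<Longrightarrow> x \<in> verts G \<Longrightarrow> 0 \<le> u i x" "card (u ` N) \<le> t"
    and "\<And>i. i \<in> N \<Longrightarrow> \<exists>P J. finite (J :: nat set) \<and> card J = card N \<and> disjoint_family_on P J \<and>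
      (\<forall>j\<in>J. P j \<subseteq> W \<and> is_bundle G (P j) \<and> 1 \<le> sum (u i) (P j))"
  shows "\<exists>A. disjoint_family_on A N \<and> (\<forall>i\<in>N. A i \<subseteq> W \<and> is_bundle G (A i) \<and> a \<le> sum (u i) (A i))"
  using assms(8-)
proof (induction "card N" arbitrary: N W)
  case 0
  then have "N = {}" by simp
  then show ?case by (simp add: disjoint_family_on_def)
next
  case (Suc r)
  \<comment> \<open>Once all vertices are worth less than \<open>a\<close>, a bundle worth 1 is not
    a single vertex, so each of its vertices in \<open>I\<close> has a neighbour in it.\<close>
  have a34: "a < 1"
  proof -
    have "a * 4 \<le> a * (7 * real t - 3)" using a(1) t by (intro mult_left_mono) auto
    then show ?thesis using a(2) by simp
  qed
  show ?case
  proof (cases "\<exists>i\<in>N. \<exists>v\<in>W. a \<le> u i v")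
    case True
    then obtain i v where i: "i \<in> N" and v: "v \<in> W" "a \<le> u i v" by blast
    have "\<exists>A. disjoint_family_on A (N - {i}) \<and>
      (\<forall>l\<in>N - {i}. A l \<subseteq> W - {v} \<and> is_bundle G (A l) \<and> a \<le> sum (u l) (A l))"
    proof (rule Suc.hyps(1))
      show "r = card (N - {i})" using Suc.hyps(2) i Suc.prems(1) by simp
      have "card (u ` (N - {i})) \<le> card (u ` N)" using Suc.prems(1) by (intro card_mono) auto
      then show "card (u ` (N - {i})) \<le> t" using Suc.prems(4) by simp
      fix l assume "l \<in> N - {i}"
      then obtain P J where P: "finite (J :: nat set)" "card J = card N" "disjoint_family_on P J"
        "\<forall>j\<in>J. P j \<subseteq> W \<and> is_bundle G (P j) \<and> 1 \<le> sum (u l) (P j)" using Suc.prems(5)[of l] by blast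
      have "J \<noteq> {}" using P(2) Suc.hyps(2) by auto
      \<comment> \<open>\<open>v\<close> spoils at most one bundle; if it spoils none, an arbitrary
        one is dropped to match the number of agents.\<close>
      then have "\<exists>j0\<in>J. \<forall>j\<in>J - {j0}. v \<notin> P j"
      proof (cases "\<exists>j\<in>J. v \<in> P j")
        case True
        then obtain j0 where "j0 \<in> J" "v \<in> P j0" by blast
        then show ?thesis using disjoint_family_on_eq_index[OF P(3)] by blast
      qed blast
      then obtain j0 where j0: "j0 \<in> J" "\<forall>j\<in>J - {j0}. v \<notin> P j" by blast
      show "\<exists>P J. finite (J :: nat set) \<and> card J = card (N - {i}) \<and> disjoint_family_on P J \<and>
        (\<forall>j\<in>J. P j \<subseteq> W - {v} \<and> is_bundle G (P j) \<and> 1 \<le> sum (u l) (P j))"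
      proof (intro exI[of _ P] exI[of _ "J - {j0}"] conjI)
        show "disjoint_family_on P (J - {j0})" using P(3) by (auto simp: disjoint_family_on_def)
        show "card (J - {j0}) = card (N - {i})" using P(1,2) j0(1) i Suc.prems(1) by simp
      qed (use P j0 in auto)
    qed (use Suc.prems in auto)
    then obtain A where A: "disjoint_family_on A (N - {i})"
      "\<forall>l\<in>N - {i}. A l \<subseteq> W - {v} \<and> is_bundle G (A l) \<and> a \<le> sum (u l) (A l)" by blast
    have "disjoint_family_on (A(i := {v})) N" using i A by (intro allocation_insert) auto
    moreover have "is_bundle G {v}" using v(1) Suc.prems(2) by (intro is_bundle_singleton) auto
    ultimately show ?thesis using A(2) v by (intro exI[of _ "A(i := {v})"]) auto
  next
    case False
    have finV: "finite K" "finite I" using KI(1) finite_verts by (auto intro: finite_subset)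
    have WKI: "W = (W \<inter> K) \<union> (W \<inter> I)" using Suc.prems(2) KI(1) by blast
    have "\<exists>A. disjoint_family_on A N \<and> (\<forall>i\<in>N. A i \<subseteq> (W \<inter> K) \<union> (W \<inter> I) \<and> A i \<inter> (W \<inter> K) \<noteq> {} \<and>
      (\<forall>x\<in>A i \<inter> (W \<inter> I). \<exists>v\<in>A i \<inter> (W \<inter> K). x \<rightarrow>\<^bsub>G\<^esub> v) \<and> a \<le> sum (u i) (A i))"
    proof (rule small_goods_allocation[OF Suc.prems(1) _ _ _ _ _ a t Suc.prems(4)])
      show "0 \<le> u i x" if "i \<in> N" "x \<in> W \<inter> K \<union> W \<inter> I" for i x
        using that Suc.prems(2,3) WKI by blast
      show "u i x \<le> a" if "i \<in> N" "x \<in> W \<inter> I" for i x using False that by force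
      fix i assume i: "i \<in> N"
      then obtain P J where P: "finite (J :: nat set)" "card J = card N" "disjoint_family_on P J"
        "\<forall>j\<in>J. P j \<subseteq> W \<and> is_bundle G (P j) \<and> 1 \<le> sum (u i) (P j)" using Suc.prems(5) by blast
      have "\<exists>v\<in>P j \<inter> (W \<inter> K). x \<rightarrow>\<^bsub>G\<^esub> v" if j: "j \<in> J" and x: "x \<in> P j \<inter> (W \<inter> I)" for j x
      proof -
        have Pj: "P j \<subseteq> W" "is_bundle G (P j)" "1 \<le> sum (u i) (P j)" using P(4) j by auto
        have "u i x < a" using False i x by force
        then have "P j \<noteq> {x}" using Pj(3) a34 by auto
        moreover have "connected (G \<restriction> P j)" using Pj(2) x by (auto simp: is_bundle_def)
        ultimately obtain y where "y \<in> P j" "x \<rightarrow>\<^bsub>G\<^esub> y" using connected_induce_neighbour x by blast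
        moreover from this have "y \<notin> I" using indep x by blast
        ultimately show ?thesis using Pj(1) WKI by blast
      qed
      moreover have "P j \<subseteq> (W \<inter> K) \<union> (W \<inter> I)" if "j \<in> J" for j using P(4) that WKI by auto
      ultimately show "\<exists>P J. finite (J :: nat set) \<and> card J = card N \<and> disjoint_family_on P J \<and>
        (\<forall>j\<in>J. P j \<subseteq> W \<inter> K \<union> W \<inter> I \<and> (\<forall>x\<in>P j \<inter> (W \<inter> I). \<exists>v\<in>P j \<inter> (W \<inter> K). x \<rightarrow>\<^bsub>G\<^esub> v) \<and>
          1 \<le> sum (u i) (P j))"
        using P by blast
    qed (use finV KI(2) in auto)
    then obtain A where A: "disjoint_family_on A N" "\<forall>i\<in>N. A i \<subseteq> (W \<inter> K) \<union> (W \<inter> I) \<and> A i \<inter> (W \<inter> K) \<noteq> {} \<and>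
      (\<forall>x\<in>A i \<inter> (W \<inter> I). \<exists>v\<in>A i \<inter> (W \<inter> K). x \<rightarrow>\<^bsub>G\<^esub> v) \<and> a \<le> sum (u i) (A i)" by blast
    have "is_bundle G (A i)" if "i \<in> N" for i
    proof (rule is_bundle_clique_attached[of _ K I])
      show "\<exists>v\<in>A i \<inter> K. x \<rightarrow>\<^bsub>G\<^esub> v" if "x \<in> A i \<inter> I" for x using A(2) \<open>i \<in> N\<close> that by blast
    qed (use A(2) that KI(1) clique in auto)
    then show ?thesis using A WKI by blast
  qed
qed

end

section \<open>From maximin shares to packings, and the final allocation\<close>

lemma split_graphE:
  assumes "split_graph G"
  obtains K I where "K \<union> I = verts G" "K \<inter> I = {}"
    "\<And>x y. x \<in> K \<Longrightarrow> y \<in> K \<Longrightarrow> x \<noteq> y \<Longrightarrow> x \<rightarrow>\<^bsub>G\<^esub> y"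
    "\<And>x y. x \<in> I \<Longrightarrow> y \<in> I \<Longrightarrow> \<not> x \<rightarrow>\<^bsub>G\<^esub> y"
proof -
  interpret graph G using assms by (simp add: split_graph_def)
  obtain K I where KI: "K \<union> I = verts G" "K \<inter> I = {}" "complete_digraph (card K) (G \<restriction> K)" "independent_set G I"
    using assms by (auto simp: split_graph_def)
  have "x \<rightarrow>\<^bsub>G\<^esub> y" if "x \<in> K" "y \<in> K" "x \<noteq> y" for x y
  proof -
    have "x \<rightarrow>\<^bsub>G \<restriction> K\<^esub> y" using KI(3) that by (auto simp: complete_digraph_def)
    then show ?thesis by (simp add: dominates_induce_iff)
  qed
  moreover have "\<not> x \<rightarrow>\<^bsub>G\<^esub> y" if "x \<in> I" "y \<in> I" for x y
    using KI(4) that by (simp add: independent_set_def)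
  ultimately show thesis using that KI(1,2) by blast
qed

lemma mms_attained:
  assumes "graph G" "connected G" "n \<ge> 1"
  shows "\<exists>P. graph_partition G n P \<and> (\<forall>j\<in>{1..n}. mms n G u \<le> utility u (P j))"
proof -
  let ?S = "{Min ((\<lambda>j. utility u (P j)) ` {1..n}) | P. graph_partition G n P}"
  interpret graph G by (rule assms(1))
  have "mms n G u \<in> ?S"
    unfolding mms_def using finite_mms_values[OF finite_verts assms(3)] mms_values_nonempty[OF assms]
    by (rule Max_in)
  then obtain P where "graph_partition G n P" "mms n G u = Min ((\<lambda>j. utility u (P j)) ` {1..n})" by blast
  then show ?thesis by (intro exI[of _ P]) auto
qed

text \<open>Bundles lie inside \<open>verts G\<close>, so other values are never summed. This lets
  the scaling depend only on an agent's type.\<close>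

lemma mms_restrict: "mms n G (restrict u (verts G)) = mms n G u"
proof -
  have "Min ((\<lambda>j. utility (restrict u (verts G)) (P j)) ` {1..n}) = Min ((\<lambda>j. utility u (P j)) ` {1..n})"
    if "graph_partition G n P" for P
  proof -
    have "utility (restrict u (verts G)) (P j) = utility u (P j)" if "j \<in> {1..n}" for j
      using \<open>graph_partition G n P\<close> that unfolding utility_def
      by (intro sum.cong) (auto simp: graph_partition_def is_bundle_def)
    then show ?thesis by (intro arg_cong[of _ _ Min] image_cong) auto
  qed
  then have "{Min ((\<lambda>j. utility (restrict u (verts G)) (P j)) ` {1..n}) | P. graph_partition G n P} =
    {Min ((\<lambda>j. utility u (P j)) ` {1..n}) | P. graph_partition G n P}" by metis
  then show ?thesis unfolding mms_def by simp
qed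

theorem theorem4:
  fixes G :: "('a,'b) pre_digraph" and k n :: nat and u :: "nat \<Rightarrow> 'a \<Rightarrow> real"
  assumes "split_graph G" and "connected G"
    and "n \<ge> 1"
    and "\<forall>i\<in>{1..n}. \<forall>v\<in>verts G. u i v \<ge> 0"
    and "card (agent_types G n u) \<le> 2 ^ k"
  shows "\<exists>A. mms_allocation (3 / (7 * 2 ^ k - 3)) G n u A"
proof -
  interpret graph G using assms(1) by (simp add: split_graph_def)
  have G: "graph G" by unfold_locales
  define a :: real where "a = 3 / (7 * 2 ^ k - 3)"
  have "(1::real) \<le> 2 ^ k" by simp
  then have "(0::real) < 7 * 2 ^ k - 3" by linarith
  then have "0 < a" "a * (7 * 2 ^ k - 3) = 3" unfolding a_def by (auto simp del: right_diff_distrib_numeral)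
  then have a: "0 < a" "a * (7 * real (2 ^ k) - 3) \<le> 3" by simp_all
  \<comment> \<open>Scaling divides by the maximin share, so it is confined to agents with a
    positive one; any bundle satisfies the others.\<close>
  define N where "N = {i \<in> {1..n}. 0 < mms n G (u i)}"
  \<comment> \<open>Defined through \<^const>\<open>restrict\<close> so that agents of the same type get
    the same function\<close>
  define normal where "normal = (\<lambda>c x. c x / mms n G c)"
  define v where "v = (\<lambda>i. normal (restrict (u i) (verts G)))"
  have v: "v i x = u i x / mms n G (u i)" if "x \<in> verts G" for i x
    using that by (simp add: v_def normal_def mms_restrict)
  have sumv: "sum (v i) X = utility (u i) X / mms n G (u i)" if "X \<subseteq> verts G" for i X
  proof -
    have "sum (v i) X = (\<Sum>x\<in>X. u i x / mms n G (u i))" using that v by (intro sum.cong) auto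
    then show ?thesis by (simp add: utility_def sum_divide_distrib)
  qed
  have finN: "finite N" by (simp add: N_def)
  obtain K I where KI: "K \<union> I = verts G" "K \<inter> I = {}"
    "\<And>x y. x \<in> K \<Longrightarrow> y \<in> K \<Longrightarrow> x \<noteq> y \<Longrightarrow> x \<rightarrow>\<^bsub>G\<^esub> y"
    "\<And>x y. x \<in> I \<Longrightarrow> y \<in> I \<Longrightarrow> \<not> x \<rightarrow>\<^bsub>G\<^esub> y"
    using split_graphE[OF assms(1)] by blast
  have "\<exists>A. disjoint_family_on A N \<and> (\<forall>i\<in>N. A i \<subseteq> verts G \<and> is_bundle G (A i) \<and> a \<le> sum (v i) (A i))"
  proof (rule split_packing_allocation[OF KI a _ finN])
    show "0 \<le> v i x" if "i \<in> N" "x \<in> verts G" for i x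
      using that assms(4) by (auto simp: v N_def)
    have "v ` N \<subseteq> normal ` agent_types G n u" by (auto simp: v_def agent_types_def N_def)
    moreover have "finite (agent_types G n u)" by (simp add: agent_types_def)
    ultimately have "card (v ` N) \<le> card (agent_types G n u)" by (meson card_image_le card_mono finite_imageI order_trans)
    then show "card (v ` N) \<le> 2 ^ k" using assms(5) by simp
    fix i assume i: "i \<in> N"
    obtain P where P: "graph_partition G n P" "\<forall>j\<in>{1..n}. mms n G (u i) \<le> utility (u i) (P j)"
      using mms_attained[OF G assms(2,3)] by blast
    \<comment> \<open>\<open>N\<close> may have fewer than \<open>n\<close> agents, so
      \<open>card N\<close> of the \<open>n\<close> maximin bundles are selected.\<close>
    have "card N \<le> card {1..n}" by (intro card_mono) (auto simp: N_def)
    then obtain J where J: "J \<subseteq> {1..n}" "card J = card N" "finite J"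
      using obtain_subset_with_card_n by blast
    show "\<exists>P J. finite (J :: nat set) \<and> card J = card N \<and> disjoint_family_on P J \<and>
      (\<forall>j\<in>J. P j \<subseteq> verts G \<and> is_bundle G (P j) \<and> 1 \<le> sum (v i) (P j))"
    proof (intro exI[of _ P] exI[of _ J] conjI ballI)
      show "disjoint_family_on P J" using P(1) J(1) by (auto simp: graph_partition_def intro: disjoint_family_on_mono)
      fix j assume "j \<in> J"
      then have j: "j \<in> {1..n}" using J(1) by blast
      show b: "is_bundle G (P j)" using P(1) j by (auto simp: graph_partition_def)
      then show "P j \<subseteq> verts G" by (simp add: is_bundle_def)
      then show "1 \<le> sum (v i) (P j)" using P(2) j i by (simp add: sumv N_def)
    qed (use J in auto)
  qed auto
  then obtain A where A: "disjoint_family_on A N"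
    "\<And>i. i \<in> N \<Longrightarrow> A i \<subseteq> verts G \<and> is_bundle G (A i) \<and> a \<le> sum (v i) (A i)" by blast
  define B where "B = (\<lambda>i. if i \<in> N then A i else {})"
  have "disjoint_family_on B {1..n}" using A(1) by (auto simp: disjoint_family_on_def B_def)
  moreover have "is_bundle G (B i)" for i using A(2) by (auto simp: B_def is_bundle_def)
  ultimately obtain B' where B': "graph_partition G n B'" "\<forall>i\<in>{1..n}. B i \<subseteq> B' i"
    using bundles_extend_to_partition[OF assms(2,3)] by blast
  have "a * mms n G (u i) \<le> utility (u i) (B' i)" if i: "i \<in> {1..n}" for i
  proof -
    have sub: "B' i \<subseteq> verts G" using B'(1) i by (auto simp: graph_partition_def is_bundle_def)
    have pos: "0 \<le> u i x" if "x \<in> B' i" for x using that sub assms(4) i by auto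
    show ?thesis
    proof (cases "i \<in> N")
      case True
      then have "0 < mms n G (u i)" by (simp add: N_def)
      then have "a * mms n G (u i) \<le> utility (u i) (A i)"
        using A(2)[OF True] sumv[of "A i" i] by (simp add: pos_le_divide_eq)
      also have "\<dots> \<le> utility (u i) (B' i)"
      proof -
        have "A i \<subseteq> B' i" using bspec[OF B'(2) i] True by (simp add: B_def)
        then show ?thesis
          unfolding utility_def using pos finite_subset[OF sub finite_verts] by (intro sum_mono2) auto
      qed
      finally show ?thesis .
    next
      case False
      then have "mms n G (u i) \<le> 0" using i by (simp add: N_def)
      then have "a * mms n G (u i) \<le> 0" using a(1) by (simp add: mult_nonneg_nonpos)
      also have "0 \<le> utility (u i) (B' i)" unfolding utility_def using pos by (rule sum_nonneg)
      finally show ?thesis .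
    qed
  qed
  then show ?thesis using B'(1) unfolding mms_allocation_def a_def by blast
qed

end
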